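(* Let $\mathcal H$ be a Hilbert space. A map $K:\mathbf F^+_{\mathbf n}\times\mathbf F^+_{\mathbf n}\to B(\mathcal H)$ is a positive semi-definite left $k$-multi-Toeplitz kernel on the direct product $\mathbf F^+_{\mathbf n}$ of free semigroups if and only if it admits a Naimark dilation.
   Context: Let $k\ge1$, $\mathbf n=(n_1,\dots,n_k)$ with $n_i\in\{1,2,\dots\}$, let $\mathbb F_{n_i}^+$ be the unital free semigroup with generators $g^i_1,\dots,g^i_{n_i}$ and identity $g^i_0$, and $\mathbf F^+_{\mathbf n}:=\mathbb F_{n_1}^+\times\cdots\times\mathbb F_{n_k}^+$ with neutral element $\mathbf g=(g^1_0,\dots,g^k_0)$. For $\omega,\gamma\in\mathbb F_n^+$ write $\gamma<_l\omega$ if $\omega=\gamma\sigma$ for some $\sigma\ne g_0$, and then $\omega\backslash_l\gamma:=\sigma$. For $\boldsymbol\omega,\boldsymbol\gamma\in\mathbf F^+_{\mathbf n}$ write $\boldsymbol\omega\sim_{lc}\boldsymbol\gamma$ if for each $i$ one of $\omega_i<_l\gamma_i$, $\gamma_i<_l\omega_i$, $\omega_i=\gamma_i$ holds; in this case $c_l^\pm(\boldsymbol\omega,\boldsymbol\gamma)=(c_l^\pm(\omega_1,\gamma_1),\dots,c_l^\pm(\omega_k,\gamma_k))$, where $c_l^+(\omega,\gamma)=\omega\backslash_l\gamma$ if $\gamma<_l\omega$ and $g_0$ otherwise, and $c_l^-(\omega,\gamma)=\gamma\backslash_l\omega$ if $\omega<_l\gamma$ and $g_0$ otherwise. $K$ is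 a left $k$-multi-Toeplitz kernel if $K(\mathbf g,\mathbf g)=I$ and $K(\boldsymbol\sigma,\boldsymbol\omega)=K(c_l^+(\boldsymbol\sigma,\boldsymbol\omega);c_l^-(\boldsymbol\sigma,\boldsymbol\omega))$ if $\boldsymbol\sigma\sim_{lc}\boldsymbol\omega$, and $K(\boldsymbol\sigma,\boldsymbol\omega)=0$ otherwise. It is positive semi-definite if $\sum_{i,j=1}^m\langle K(\boldsymbol\sigma^{(i)},\boldsymbol\sigma^{(j)})h_j,h_i\rangle\ge0$ for all $m\in\mathbb N$, $h_1,\dots,h_m\in\mathcal H$, $\boldsymbol\sigma^{(1)},\dots,\boldsymbol\sigma^{(m)}\in\mathbf F^+_{\mathbf n}$. $K$ has a Naimark dilation if there is a $k$-tuple $\mathbf V=(V_1,\dots,V_k)$ of commuting row isometries $V_i=(V_{i,1},\dots,V_{i,n_i})$ on a Hilbert space $\mathcal K\supset\mathcal H$ (i.e. for each $i$ the $V_{i,j}$ are isometries with mutually orthogonal ranges, $V_{i,s}^*V_{i,t}=\delta_{st}I$, and each entry of $V_i$ commutes with each entry of $V_s$ for $i\ne s$) such that $K(\boldsymbol\sigma,\boldsymbol\omega)=P_{\mathcal H}\mathbf V_{\boldsymbol\sigma}^*\mathbf V_{\boldsymbol\omega}|_{\mathcal H}$ for all $\boldsymbol\sigma,\boldsymbol\omega\in\mathbf F^+_{\mathbf n}$. Here $\mathbf V_{\boldsymbol\sigma}=V_{1,\sigma_1}\cdots V_{k,\sigma_k}$, $V_{i,\sigma_i}=V_{i,j_1}\cdots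 V_{i,j_p}$ if $\sigma_i=g^i_{j_1}\cdots g^i_{j_p}$, $V_{i,g^i_0}=I$. *)

theory Defs
  imports Complex_Main "HOL-Library.Function_Algebras" "HOL-Library.Nonpos_Ints"
    "HOL-Library.Sublist"
begin

text \<open>
  A complex Hilbert space is carried by a linear subspace \<open>hcarrier X\<close> of an ambient complex vector
  space (the type \<open>'a\<close> with scalar multiplication \<open>hscale X\<close>). The ambient space carries no topology
  and plays no role outside \<open>hcarrier X\<close>; \<open>hcarrier X = UNIV\<close> is allowed. Hilbert spaces are thus
  values, so that one can quantify existentially over them.
\<close>

record 'a hspace =
  hcarrier :: "'a set"
  hscale :: "complex \<Rightarrow> 'a \<Rightarrow> 'a"
  hinner :: "'a \<Rightarrow> 'a \<Rightarrow> complex"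

definition hnorm :: "'a hspace \<Rightarrow> 'a \<Rightarrow> real"
  where "hnorm X x = sqrt (Re (hinner X x x))"

text \<open>The inner product is linear in the first argument.\<close>

locale hilbert_space = vector_space "hscale X" for X :: "'a::ab_group_add hspace" +
  assumes subspace_hcarrier: "subspace (hcarrier X)"
    and hinner_add_left: "\<lbrakk>x \<in> hcarrier X; y \<in> hcarrier X; z \<in> hcarrier X\<rbrakk>
      \<Longrightarrow> hinner X (x + y) z = hinner X x z + hinner X y z"
    and hinner_scale_left: "\<lbrakk>x \<in> hcarrier X; y \<in> hcarrier X\<rbrakk>
      \<Longrightarrow> hinner X (hscale X c x) y = c * hinner X x y"
    and hinner_commute: "\<lbrakk>x \<in> hcarrier X; y \<in> hcarrier X\<rbrakk>
      \<Longrightarrow> hinner X y x = cnj (hinner X x y)"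
    and hinner_self_nonneg: "x \<in> hcarrier X \<Longrightarrow> hinner X x x \<in> \<real>\<^sub>\<ge>\<^sub>0"
    and hinner_self_eq_0: "\<lbrakk>x \<in> hcarrier X; hinner X x x = 0\<rbrakk> \<Longrightarrow> x = 0"
    and complete: "\<lbrakk>\<And>n. f n \<in> hcarrier X;
        \<And>e. e > 0 \<Longrightarrow> \<exists>N::nat. \<forall>m\<ge>N. \<forall>n\<ge>N. hnorm X (f m - f n) < e\<rbrakk>
      \<Longrightarrow> \<exists>x\<in>hcarrier X. (\<lambda>n. hnorm X (f n - x)) \<longlonglongrightarrow> 0"

text \<open>
  Operators are functions on the ambient types of which only the restriction to the carrier matters.
\<close>

definition linear_op :: "'a::ab_group_add hspace \<Rightarrow> 'b::ab_group_add hspace \<Rightarrow> ('a \<Rightarrow> 'b) \<Rightarrow> bool"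
  where "linear_op X Y T \<longleftrightarrow>
    (\<forall>x\<in>hcarrier X. T x \<in> hcarrier Y) \<and>
    (\<forall>x\<in>hcarrier X. \<forall>y\<in>hcarrier X. T (x + y) = T x + T y) \<and>
    (\<forall>c. \<forall>x\<in>hcarrier X. T (hscale X c x) = hscale Y c (T x))"

definition bounded_op :: "'a::ab_group_add hspace \<Rightarrow> ('a \<Rightarrow> 'a) \<Rightarrow> bool"
  where "bounded_op X T \<longleftrightarrow>
    linear_op X X T \<and> (\<exists>C. \<forall>x\<in>hcarrier X. hnorm X (T x) \<le> C * hnorm X x)"

definition isometry :: "'a::ab_group_add hspace \<Rightarrow> 'b::ab_group_add hspace \<Rightarrow> ('a \<Rightarrow> 'b) \<Rightarrow> bool"
  where "isometry X Y T \<longleftrightarrow> linear_op X Y T \<and> (\<forall>x\<in>hcarrier X. hnorm Y (T x) = hnorm X x)"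

definition adj :: "'a hspace \<Rightarrow> ('a \<Rightarrow> 'a) \<Rightarrow> 'a \<Rightarrow> 'a"
  where "adj X T y =
    (THE z. z \<in> hcarrier X \<and> (\<forall>x\<in>hcarrier X. hinner X (T x) y = hinner X x z))"

text \<open>Orthogonal projection onto a closed subspace \<open>M\<close>.\<close>

definition orth_proj :: "'a::ab_group_add hspace \<Rightarrow> 'a set \<Rightarrow> 'a \<Rightarrow> 'a"
  where "orth_proj X M x = (THE m. m \<in> M \<and> (\<forall>y\<in>M. hinner X (x - m) y = 0))"

text \<open>
  The tuple \<open>(n\<^sub>1, \<dots>, n\<^sub>k)\<close> is the list \<open>ns\<close>. A word in the generators \<open>g\<^sup>i\<^sub>1, \<dots>, g\<^sup>i\<^sub>n\<close> is the list of
  its subscripts, the empty list being the identity. Positions in the tuple are counted from 0.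
\<close>

definition multiwords :: "nat list \<Rightarrow> nat list list set"
  where "multiwords ns =
    {\<sigma>. length \<sigma> = length ns \<and> (\<forall>i<length ns. \<sigma> ! i \<in> lists {1..ns ! i})}"

definition neutral :: "nat list \<Rightarrow> nat list list"
  where "neutral ns = replicate (length ns) []"

text \<open>\<open>\<gamma> <\<^sub>l \<omega>\<close> is \<open>strict_prefix \<gamma> \<omega>\<close>; then \<open>drop (length \<gamma>) \<omega>\<close> is the \<open>\<sigma>\<close> with \<open>\<omega> = \<gamma> @ \<sigma>\<close>.\<close>

definition left_comparable :: "'c list list \<Rightarrow> 'c list list \<Rightarrow> bool"
  where "left_comparable =
    list_all2 (\<lambda>\<omega> \<gamma>. strict_prefix \<omega> \<gamma> \<or> strict_prefix \<gamma> \<omega> \<or> \<omega> = \<gamma>)"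

definition c_plus :: "'c list \<Rightarrow> 'c list \<Rightarrow> 'c list"
  where "c_plus \<omega> \<gamma> = (if strict_prefix \<gamma> \<omega> then drop (length \<gamma>) \<omega> else [])"

definition c_minus :: "'c list \<Rightarrow> 'c list \<Rightarrow> 'c list"
  where "c_minus \<omega> \<gamma> = (if strict_prefix \<omega> \<gamma> then drop (length \<omega>) \<gamma> else [])"

type_synonym 'a kernel = "nat list list \<Rightarrow> nat list list \<Rightarrow> 'a \<Rightarrow> 'a"

definition multi_toeplitz :: "nat list \<Rightarrow> 'a::ab_group_add hspace \<Rightarrow> 'a kernel \<Rightarrow> bool"
  where "multi_toeplitz ns H K \<longleftrightarrow>
    (\<forall>h\<in>hcarrier H. K (neutral ns) (neutral ns) h = h) \<and>
    (\<forall>\<sigma>\<in>multiwords ns. \<forall>\<omega>\<in>multiwords ns. \<forall>h\<in>hcarrier H.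
      K \<sigma> \<omega> h =
        (if left_comparable \<sigma> \<omega> then K (map2 c_plus \<sigma> \<omega>) (map2 c_minus \<sigma> \<omega>) h else 0))"

definition pos_semidef :: "nat list \<Rightarrow> 'a hspace \<Rightarrow> 'a kernel \<Rightarrow> bool"
  where "pos_semidef ns H K \<longleftrightarrow>
    (\<forall>(m::nat) h \<sigma>. (\<forall>i<m. h i \<in> hcarrier H \<and> \<sigma> i \<in> multiwords ns) \<longrightarrow>
      (\<Sum>i<m. \<Sum>j<m. hinner H (K (\<sigma> i) (\<sigma> j) (h j)) (h i)) \<in> \<real>\<^sub>\<ge>\<^sub>0)"

text \<open>A row operator \<open>(A\<^sub>1, \<dots>, A\<^sub>n)\<close> is given by its entries \<open>A j\<close> for \<open>j \<in> {1..n}\<close>.\<close>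

definition row_isometry :: "'a::ab_group_add hspace \<Rightarrow> nat \<Rightarrow> (nat \<Rightarrow> 'a \<Rightarrow> 'a) \<Rightarrow> bool"
  where "row_isometry X n A \<longleftrightarrow>
    (\<forall>j\<in>{1..n}. isometry X X (A j)) \<and>
    (\<forall>s\<in>{1..n}. \<forall>t\<in>{1..n}. s \<noteq> t \<longrightarrow>
      (\<forall>x\<in>hcarrier X. \<forall>y\<in>hcarrier X. hinner X (A s x) (A t y) = 0))"

definition commuting_row_isometries ::
    "'a::ab_group_add hspace \<Rightarrow> nat list \<Rightarrow> (nat \<Rightarrow> nat \<Rightarrow> 'a \<Rightarrow> 'a) \<Rightarrow> bool"
  where "commuting_row_isometries X ns V \<longleftrightarrow>
    (\<forall>i<length ns. row_isometry X (ns ! i) (V i)) \<and>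
    (\<forall>i<length ns. \<forall>s<length ns. i \<noteq> s \<longrightarrow>
      (\<forall>j\<in>{1..ns ! i}. \<forall>t\<in>{1..ns ! s}. \<forall>x\<in>hcarrier X. V i j (V s t x) = V s t (V i j x)))"

text \<open>
  Since \<open>foldr f [a\<^sub>1, \<dots>, a\<^sub>p] x = f a\<^sub>1 (\<dots> (f a\<^sub>p x))\<close>, the inner fold is the product of the \<open>V i j\<close>
  along the word \<open>\<sigma> ! i\<close>, and the outer one multiplies these products in the order of \<open>i\<close>.
\<close>

definition multiword_op :: "(nat \<Rightarrow> nat \<Rightarrow> 'a \<Rightarrow> 'a) \<Rightarrow> nat list list \<Rightarrow> 'a \<Rightarrow> 'a"
  where "multiword_op V \<sigma> = foldr (\<lambda>i. foldr (V i) (\<sigma> ! i)) [0..<length \<sigma>]"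

text \<open>
  The inclusion of \<open>H\<close> into the dilation space \<open>X\<close> is an isometric embedding \<open>J\<close>, along which the
  dilation identity is read inside \<open>X\<close>.
\<close>

definition naimark_dilation ::
    "nat list \<Rightarrow> 'a::ab_group_add hspace \<Rightarrow> 'a kernel \<Rightarrow>
      'b::ab_group_add hspace \<Rightarrow> ('a \<Rightarrow> 'b) \<Rightarrow> (nat \<Rightarrow> nat \<Rightarrow> 'b \<Rightarrow> 'b) \<Rightarrow> bool"
  where "naimark_dilation ns H K X J V \<longleftrightarrow>
    hilbert_space X \<and> isometry H X J \<and> commuting_row_isometries X ns V \<and>
    (\<forall>\<sigma>\<in>multiwords ns. \<forall>\<omega>\<in>multiwords ns. \<forall>h\<in>hcarrier H.
      J (K \<sigma> \<omega> h) =
        orth_proj X (J ` hcarrier H) (adj X (multiword_op V \<sigma>) (multiword_op V \<omega> (J h))))"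

text \<open>HOL cannot quantify over types, so the ambient type \<open>'b\<close> of the dilation space is a
  parameter. A dilation in any type yields one in \<open>nat list list \<Rightarrow> 'a\<close>, where the reproducing kernel
  space of \<open>K\<close> (functions from multiwords to \<open>H\<close>) lives.\<close>

definition has_naimark_dilation ::
    "'b::ab_group_add itself \<Rightarrow> nat list \<Rightarrow> 'a::ab_group_add hspace \<Rightarrow> 'a kernel \<Rightarrow> bool"
  where "has_naimark_dilation _ ns H K \<longleftrightarrow>
    (\<exists>(X :: 'b hspace) J V. naimark_dilation ns H K X J V)"

end

theory Submission
  imports Defs
begin

text \<open>
  For the existence of a dilation, let \<open>X\<close> be the reproducing kernel Hilbert space of \<open>K\<close>, the
  completion of the span of the vectors \<open>e \<omega> h\<close> with \<open>\<langle>e \<omega> h, e \<sigma> k\<rangle> = \<langle>K \<sigma> \<omega> h, k\<rangle>\<close>. The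
  multi-Toeplitz property says that prepending the letter \<open>j\<close> to the \<open>i\<close>-th component of all words
  leaves these inner products unchanged, and that prepending different letters to the \<open>i\<close>-th
  components makes them vanish. So \<open>e \<omega> h \<mapsto> e (\<omega>[i := j # \<omega> ! i]) h\<close> extends to isometries \<open>V i j\<close>
  which form commuting row isometries; they dilate \<open>K\<close> along \<open>h \<mapsto> e (neutral ns) h\<close>.
  Conversely, \<open>\<langle>K \<sigma> \<omega> h, k\<rangle> = \<langle>V\<^sub>\<omega> h, V\<^sub>\<sigma> k\<rangle>\<close> is a Gram matrix, hence positive. If all components of
  \<open>\<sigma>\<close> and \<open>\<omega>\<close> are comparable, their common prefixes can be moved to the left in both products
  and cancel as an isometry; if some component is not, the two ranges are orthogonal.
\<close>

section \<open>Semi-inner product spaces\<close>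

text \<open>Positivity of \<open>K\<close> only gives a possibly degenerate form on the finitely
  supported functions from multiwords to \<open>H\<close>; hence the notion of a semi-inner product
  space. Symmetry of the form is not part of the hypotheses and is recovered from its being real on
  the diagonal. The dilation space has to live in a type fixed in advance, so quotient and
  completion are carried out together: u is sent to the function mapping \<sigma> to the sum of the
  \<open>K \<sigma> \<omega> (u \<omega>)\<close>. This map kills exactly the vectors of seminorm
  zero, and inner products against a finitely supported v only see finitely many of its values, so
  pointwise limits determine Cauchy sequences up to null sequences. The vectors
  \<open>e \<omega> h\<close> may satisfy linear relations, so the rule for \<open>V i j\<close>
  does not obviously define a map. Equality of Gram matrices settles this and the extension by
  continuity at once. The adjoint and the projection in the dilation identity are likewise traded
  for an identity of inner products, so both directions only compare Gram matrices.\<close>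

locale semi_inner_space = vector_space "hscale X" for X :: "'a::ab_group_add hspace" +
  assumes subspace_hcarrier: "subspace (hcarrier X)"
    and hinner_add_left: "\<lbrakk>x \<in> hcarrier X; y \<in> hcarrier X; z \<in> hcarrier X\<rbrakk>
      \<Longrightarrow> hinner X (x + y) z = hinner X x z + hinner X y z"
    and hinner_scale_left: "\<lbrakk>x \<in> hcarrier X; y \<in> hcarrier X\<rbrakk>
      \<Longrightarrow> hinner X (hscale X c x) y = c * hinner X x y"
    and hinner_commute: "\<lbrakk>x \<in> hcarrier X; y \<in> hcarrier X\<rbrakk>
      \<Longrightarrow> hinner X y x = cnj (hinner X x y)"
    and hinner_self_nonneg: "x \<in> hcarrier X \<Longrightarrow> hinner X x x \<in> \<real>\<^sub>\<ge>\<^sub>0"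
begin

lemma mem_zero [simp]: "0 \<in> hcarrier X"
  and mem_add [simp]: "x \<in> hcarrier X \<Longrightarrow> y \<in> hcarrier X \<Longrightarrow> x + y \<in> hcarrier X"
  and mem_scale [simp]: "x \<in> hcarrier X \<Longrightarrow> hscale X c x \<in> hcarrier X"
  and mem_uminus [simp]: "x \<in> hcarrier X \<Longrightarrow> - x \<in> hcarrier X"
  and mem_diff [simp]: "x \<in> hcarrier X \<Longrightarrow> y \<in> hcarrier X \<Longrightarrow> x - y \<in> hcarrier X"
  using subspace_hcarrier
  by (simp_all add: subspace_0 subspace_add subspace_scale subspace_neg subspace_diff)

lemma mem_sum [simp]: "(\<And>i. i \<in> A \<Longrightarrow> f i \<in> hcarrier X) \<Longrightarrow> sum f A \<in> hcarrier X"
  by (induction A rule: infinite_finite_induct) auto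

lemma hinner_zero_left [simp]: "y \<in> hcarrier X \<Longrightarrow> hinner X 0 y = 0"
  using hinner_scale_left[of 0 y 0] by simp

lemma hinner_uminus_left: "x \<in> hcarrier X \<Longrightarrow> y \<in> hcarrier X \<Longrightarrow> hinner X (- x) y = - hinner X x y"
  using hinner_scale_left[of x y "-1"] by simp

lemma hinner_diff_left:
  "x \<in> hcarrier X \<Longrightarrow> y \<in> hcarrier X \<Longrightarrow> z \<in> hcarrier X \<Longrightarrow>
    hinner X (x - y) z = hinner X x z - hinner X y z"
  using hinner_add_left[of x "- y" z] by (simp add: hinner_uminus_left)

lemma hinner_add_right:
  "x \<in> hcarrier X \<Longrightarrow> y \<in> hcarrier X \<Longrightarrow> z \<in> hcarrier X \<Longrightarrow>
    hinner X z (x + y) = hinner X z x + hinner X z y"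
  using hinner_commute[of "x + y" z] hinner_commute[of x z] hinner_commute[of y z]
  by (simp add: hinner_add_left)

lemma hinner_diff_right:
  "x \<in> hcarrier X \<Longrightarrow> y \<in> hcarrier X \<Longrightarrow> z \<in> hcarrier X \<Longrightarrow>
    hinner X z (x - y) = hinner X z x - hinner X z y"
  using hinner_commute[of "x - y" z] hinner_commute[of x z] hinner_commute[of y z]
  by (simp add: hinner_diff_left)

lemma hinner_scale_right:
  "x \<in> hcarrier X \<Longrightarrow> y \<in> hcarrier X \<Longrightarrow> hinner X x (hscale X c y) = cnj c * hinner X x y"
  using hinner_commute[of "hscale X c y" x] hinner_commute[of y x]
  by (simp add: hinner_scale_left)

lemma hinner_zero_right [simp]: "x \<in> hcarrier X \<Longrightarrow> hinner X x 0 = 0"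
  using hinner_scale_right[of x 0 0] by simp

lemma hinner_sum_left:
  assumes "\<And>i. i \<in> A \<Longrightarrow> f i \<in> hcarrier X" "y \<in> hcarrier X"
  shows "hinner X (sum f A) y = (\<Sum>i\<in>A. hinner X (f i) y)"
  using assms(1)
proof (induction A rule: infinite_finite_induct)
  case (insert i A)
  then show ?case
    using assms(2) hinner_add_left[of "f i" "sum f A" y] by simp
qed (use assms(2) in auto)

lemma hinner_sum_right:
  assumes "\<And>i. i \<in> A \<Longrightarrow> f i \<in> hcarrier X" "y \<in> hcarrier X"
  shows "hinner X y (sum f A) = (\<Sum>i\<in>A. hinner X y (f i))"
  using assms(1)
proof (induction A rule: infinite_finite_induct)
  case (insert i A)
  then show ?case
    using assms(2) hinner_add_right[of "f i" "sum f A" y] by simp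
qed (use assms(2) in auto)

lemma hnorm_nonneg [simp]: "x \<in> hcarrier X \<Longrightarrow> 0 \<le> hnorm X x"
  using hinner_self_nonneg[of x] by (auto simp: hnorm_def complex_nonneg_Reals_iff)

lemma hinner_self: "x \<in> hcarrier X \<Longrightarrow> hinner X x x = complex_of_real ((hnorm X x)\<^sup>2)"
  using hinner_self_nonneg[of x]
  by (auto simp: hnorm_def complex_nonneg_Reals_iff complex_eq_iff)

lemma hnorm_zero [simp]: "hnorm X 0 = 0"
  by (simp add: hnorm_def)

lemma hnorm_scale: "x \<in> hcarrier X \<Longrightarrow> hnorm X (hscale X c x) = cmod c * hnorm X x"
proof -
  assume x: "x \<in> hcarrier X"
  have "hinner X (hscale X c x) (hscale X c x) = complex_of_real ((cmod c * hnorm X x)\<^sup>2)"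
    using x complex_norm_square[of c]
    by (simp add: hinner_scale_left hinner_scale_right hinner_self[OF x] power_mult_distrib ac_simps)
  then show ?thesis
    using x by (simp add: hnorm_def[of X "hscale X c x"])
qed

lemma hnorm_uminus [simp]: "x \<in> hcarrier X \<Longrightarrow> hnorm X (- x) = hnorm X x"
  using hnorm_scale[of x "-1"] by simp

lemma hnorm_minus_commute: "x \<in> hcarrier X \<Longrightarrow> y \<in> hcarrier X \<Longrightarrow> hnorm X (x - y) = hnorm X (y - x)"
  using hnorm_uminus[of "x - y"] by simp

lemma hnorm_add_sq:
  assumes "x \<in> hcarrier X" "y \<in> hcarrier X"
  shows "(hnorm X (x + y))\<^sup>2 = (hnorm X x)\<^sup>2 + 2 * Re (hinner X x y) + (hnorm X y)\<^sup>2"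
proof -
  have "complex_of_real ((hnorm X (x + y))\<^sup>2) = hinner X (x + y) (x + y)"
    using assms by (simp add: hinner_self)
  also have "\<dots> = hinner X x x + (hinner X x y + cnj (hinner X x y)) + hinner X y y"
    using assms hinner_commute[of x y] by (simp add: hinner_add_left hinner_add_right)
  also have "\<dots> = complex_of_real ((hnorm X x)\<^sup>2 + 2 * Re (hinner X x y) + (hnorm X y)\<^sup>2)"
    using assms by (simp add: hinner_self complex_add_cnj)
  finally show ?thesis
    using of_real_eq_iff by blast
qed

lemma hnorm_diff_sq:
  assumes "x \<in> hcarrier X" "y \<in> hcarrier X"
  shows "(hnorm X (x - y))\<^sup>2 = (hnorm X x)\<^sup>2 - 2 * Re (hinner X x y) + (hnorm X y)\<^sup>2"
  using hnorm_add_sq[of x "- y"] hinner_diff_right[of 0 y x] assms by simp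

text \<open>The form may be degenerate, so \<open>hnorm X y = 0\<close> does not give
  \<open>y = 0\<close> and needs a case of its own. Subtracting from x the multiple of y by t times
  \<open>hinner X x y\<close>, with t real, makes the cross term real; what remains is a real
  quadratic in t.\<close>

lemma cauchy_schwarz:
  assumes x: "x \<in> hcarrier X" and y: "y \<in> hcarrier X"
  shows "cmod (hinner X x y) \<le> hnorm X x * hnorm X y"
proof -
  define a b c where "a = (hnorm X x)\<^sup>2" and "b = (cmod (hinner X x y))\<^sup>2" and "c = (hnorm X y)\<^sup>2"
  have nonneg: "0 \<le> a" "0 \<le> b" "0 \<le> c"
    by (simp_all add: a_def b_def c_def)
  have quad: "0 \<le> a - 2 * t * b + t\<^sup>2 * b * c" for t
  proof -
    let ?z = "complex_of_real t * hinner X x y"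
    have "0 \<le> (hnorm X (x - hscale X ?z y))\<^sup>2"
      by simp
    also have "\<dots> = a - 2 * Re (cnj ?z * hinner X x y) + (cmod ?z)\<^sup>2 * c"
      using x y by (simp add: hnorm_diff_sq hinner_scale_right hnorm_scale a_def c_def
          power_mult_distrib)
    also have "cnj ?z * hinner X x y = complex_of_real (t * b)"
      unfolding b_def of_real_mult complex_norm_square by simp
    also have "(cmod ?z)\<^sup>2 = t\<^sup>2 * b"
      by (simp add: b_def norm_mult power_mult_distrib)
    finally show ?thesis
      by simp
  qed
  have "b \<le> a * c"
  proof (cases "c = 0")
    case True
    have "b = 0"
    proof (rule ccontr)
      assume "b \<noteq> 0"
      \<comment> \<open>With \<open>c = 0\<close> the quadratic is affine in t, and this t gives it
        the value -1.\<close>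
      then show False
        using quad[of "(a + 1) / (2 * b)"] True by simp
    qed
    with True show ?thesis by simp
  next
    case False
    with nonneg have "c > 0" by simp
    \<comment> \<open>\<open>1 / c\<close> minimizes the quadratic.\<close>
    moreover have "0 \<le> a - b / c"
      using quad[of "1 / c"] False by (simp add: power2_eq_square)
    ultimately show ?thesis
      by (simp add: field_simps)
  qed
  then have "(cmod (hinner X x y))\<^sup>2 \<le> (hnorm X x * hnorm X y)\<^sup>2"
    by (simp add: a_def b_def c_def power_mult_distrib)
  then show ?thesis
    using x y by (meson abs_le_square_iff power2_le_imp_le mult_nonneg_nonneg hnorm_nonneg)
qed

lemma hnorm_triangle:
  assumes x: "x \<in> hcarrier X" and y: "y \<in> hcarrier X"
  shows "hnorm X (x + y) \<le> hnorm X x + hnorm X y"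
proof -
  have "Re (hinner X x y) \<le> hnorm X x * hnorm X y"
    using cauchy_schwarz[OF x y] complex_Re_le_cmod order_trans by blast
  then have "(hnorm X (x + y))\<^sup>2 \<le> (hnorm X x + hnorm X y)\<^sup>2"
    using hnorm_add_sq[OF x y] by (simp add: power2_sum)
  then show ?thesis
    using x y by (meson power2_le_imp_le add_nonneg_nonneg hnorm_nonneg)
qed

lemma hnorm_triangle_diff:
  assumes "x \<in> hcarrier X" "y \<in> hcarrier X" "z \<in> hcarrier X"
  shows "hnorm X (x - z) \<le> hnorm X (x - y) + hnorm X (y - z)"
  using hnorm_triangle[of "x - y" "y - z"] assms by simp

lemma parallelogram:
  assumes "x \<in> hcarrier X" "y \<in> hcarrier X"
  shows "(hnorm X (x + y))\<^sup>2 + (hnorm X (x - y))\<^sup>2 = 2 * (hnorm X x)\<^sup>2 + 2 * (hnorm X y)\<^sup>2"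
  using hnorm_add_sq[OF assms] hnorm_diff_sq[OF assms] by simp

end

sublocale hilbert_space \<subseteq> semi_inner_space X
  by unfold_locales
    (fact subspace_hcarrier hinner_add_left hinner_scale_left hinner_commute hinner_self_nonneg)+

lemma (in hilbert_space) hnorm_eq_0D: "x \<in> hcarrier X \<Longrightarrow> hnorm X x = 0 \<Longrightarrow> x = 0"
  by (simp add: hinner_self hinner_self_eq_0)

lemma (in hilbert_space) hinner_eqI:
  assumes "x \<in> hcarrier X" "y \<in> hcarrier X"
    and "\<And>z. z \<in> hcarrier X \<Longrightarrow> hinner X z x = hinner X z y"
  shows "x = y"
  using hinner_self_eq_0[of "x - y"] assms by (simp add: hinner_diff_right)

lemma (in hilbert_space) hinner_left_eqI:
  assumes "x \<in> hcarrier X" "y \<in> hcarrier X"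
    and "\<And>z. z \<in> hcarrier X \<Longrightarrow> hinner X x z = hinner X y z"
  shows "x = y"
  using hinner_self_eq_0[of "x - y"] assms by (simp add: hinner_diff_left)

lemma linear_opD:
  assumes "linear_op X Y T"
  shows "x \<in> hcarrier X \<Longrightarrow> T x \<in> hcarrier Y"
    and "x \<in> hcarrier X \<Longrightarrow> y \<in> hcarrier X \<Longrightarrow> T (x + y) = T x + T y"
    and "x \<in> hcarrier X \<Longrightarrow> T (hscale X c x) = hscale Y c (T x)"
  using assms by (auto simp: linear_op_def)

lemma linear_op_zero:
  assumes "semi_inner_space X" "linear_op X Y T"
  shows "T 0 = 0"
proof -
  interpret X: semi_inner_space X by fact
  show ?thesis
    using linear_opD(2)[OF assms(2), of 0 0] by simp
qed

lemma linear_op_diff: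
  assumes "semi_inner_space X" "linear_op X Y T" "x \<in> hcarrier X" "y \<in> hcarrier X"
  shows "T (x - y) = T x - T y"
proof -
  interpret X: semi_inner_space X by fact
  show ?thesis
    using linear_opD(2)[OF assms(2), of "x - y" y] assms by (simp add: algebra_simps)
qed

lemma isometryD:
  assumes "isometry X Y T"
  shows "linear_op X Y T" "x \<in> hcarrier X \<Longrightarrow> T x \<in> hcarrier Y"
    "x \<in> hcarrier X \<Longrightarrow> hnorm Y (T x) = hnorm X x"
  using assms by (auto simp: isometry_def linear_op_def)

text \<open>Polarization, since \<open>isometry\<close> only speaks of norms: the norm of a sum
  determines the real part of the inner product, and multiplying x by -i turns the imaginary part
  into a real part.\<close>

lemma isometry_hinner:
  assumes "semi_inner_space X" "semi_inner_space Y" and iso: "isometry X Y T"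
    and x: "x \<in> hcarrier X" and y: "y \<in> hcarrier X"
  shows "hinner Y (T x) (T y) = hinner X x y"
proof -
  interpret X: semi_inner_space X by fact
  interpret Y: semi_inner_space Y by fact
  note T = linear_opD[OF isometryD(1)[OF iso]]
  have Re_eq: "Re (hinner Y (T u) (T v)) = Re (hinner X u v)"
    if "u \<in> hcarrier X" "v \<in> hcarrier X" for u v
    using X.hnorm_add_sq[of u v] Y.hnorm_add_sq[of "T u" "T v"] that
      isometryD(3)[OF iso, of u] isometryD(3)[OF iso, of v] isometryD(3)[OF iso, of "u + v"]
    by (simp add: T)
  have "Im (hinner Y (T x) (T y)) = Re (hinner Y (T (hscale X (- \<i>) x)) (T y))"
    using x y by (simp add: T Y.hinner_scale_left del: X.scale_minus_left Y.scale_minus_left)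
  also have "\<dots> = Re (hinner X (hscale X (- \<i>) x) y)"
    using x y by (intro Re_eq) auto
  also have "\<dots> = Im (hinner X x y)"
    using x y by (simp add: X.hinner_scale_left del: X.scale_minus_left)
  finally show ?thesis
    using Re_eq[OF x y] by (simp add: complex_eq_iff)
qed

lemma isometryI:
  assumes "linear_op X Y T" "\<And>x. x \<in> hcarrier X \<Longrightarrow> hinner Y (T x) (T x) = hinner X x x"
  shows "isometry X Y T"
  using assms by (simp add: isometry_def hnorm_def)

section \<open>Convergence and Cauchy sequences with respect to the seminorm\<close>

lemma null_comparison:
  fixes f :: "nat \<Rightarrow> 'a::real_normed_vector"
  assumes "\<And>n. norm (f n) \<le> g n" "g \<longlonglongrightarrow> 0"
  shows "f \<longlonglongrightarrow> 0"
proof (rule tendsto_0_le[OF assms(2), where K = 1])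
  show "\<forall>\<^sub>F n in sequentially. norm (f n) \<le> norm (g n) * 1"
    using assms(1) by (intro always_eventually allI) (metis abs_ge_self mult.right_neutral order_trans real_norm_def)
qed

text \<open>The ambient type has no topology, so convergence is expressed through
  \<open>hnorm\<close>. Membership in the carrier is bundled in because the laws of the inner
  product hold only there.\<close>

definition hCauchy :: "'a::ab_group_add hspace \<Rightarrow> (nat \<Rightarrow> 'a) \<Rightarrow> bool"
  where "hCauchy X f \<longleftrightarrow> (\<forall>n. f n \<in> hcarrier X) \<and>
    (\<forall>e>0. \<exists>N. \<forall>m\<ge>N. \<forall>n\<ge>N. hnorm X (f m - f n) < e)"

definition hlim :: "'a::ab_group_add hspace \<Rightarrow> (nat \<Rightarrow> 'a) \<Rightarrow> 'a \<Rightarrow> bool"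
  where "hlim X f x \<longleftrightarrow> (\<forall>n. f n \<in> hcarrier X) \<and> x \<in> hcarrier X \<and>
    (\<lambda>n. hnorm X (f n - x)) \<longlonglongrightarrow> 0"

lemma (in hilbert_space) hCauchy_converges: "hCauchy X f \<Longrightarrow> \<exists>x. hlim X f x"
  using complete[of f] by (auto simp: hCauchy_def hlim_def)

context semi_inner_space
begin

lemma hlim_const: "x \<in> hcarrier X \<Longrightarrow> hlim X (\<lambda>n. x) x"
  by (simp add: hlim_def)

lemma hlim_add:
  assumes "hlim X f x" "hlim X g y"
  shows "hlim X (\<lambda>n. f n + g n) (x + y)"
proof -
  have "(\<lambda>n. hnorm X (f n - x) + hnorm X (g n - y)) \<longlonglongrightarrow> 0"
    using assms by (intro tendsto_add_zero) (auto simp: hlim_def)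
  moreover have "hnorm X (f n + g n - (x + y)) \<le> hnorm X (f n - x) + hnorm X (g n - y)" for n
    using hnorm_triangle[of "f n - x" "g n - y"] assms by (simp add: hlim_def algebra_simps)
  ultimately have "(\<lambda>n. hnorm X (f n + g n - (x + y))) \<longlonglongrightarrow> 0"
    using assms by (elim null_comparison[rotated]) (simp_all add: hlim_def)
  with assms show ?thesis
    by (simp add: hlim_def)
qed

lemma hlim_scale:
  assumes "hlim X f x"
  shows "hlim X (\<lambda>n. hscale X c (f n)) (hscale X c x)"
proof -
  have "(\<lambda>n. cmod c * hnorm X (f n - x)) \<longlonglongrightarrow> cmod c * 0"
    using assms by (intro tendsto_mult) (auto simp: hlim_def)
  moreover have "hnorm X (hscale X c (f n) - hscale X c x) = cmod c * hnorm X (f n - x)" for n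
    using assms by (subst hnorm_scale[symmetric]) (auto simp: hlim_def scale_right_diff_distrib)
  ultimately show ?thesis
    using assms by (simp add: hlim_def)
qed

lemma hlim_diff:
  assumes "hlim X f x" "hlim X g y"
  shows "hlim X (\<lambda>n. f n - g n) (x - y)"
  using hlim_add[OF assms(1) hlim_scale[OF assms(2), of "-1"]] by simp

lemma hlim_hCauchy:
  assumes "hlim X f x"
  shows "hCauchy X f"
  unfolding hCauchy_def
proof (intro conjI allI impI)
  show "f n \<in> hcarrier X" for n
    using assms by (simp add: hlim_def)
  fix e :: real assume "e > 0"
  then obtain N where N: "\<And>n. n \<ge> N \<Longrightarrow> hnorm X (f n - x) < e / 2"
    using assms LIMSEQ_D[of "\<lambda>n. hnorm X (f n - x)" 0 "e / 2"]
    by (auto simp: hlim_def abs_less_iff)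
  show "\<exists>N. \<forall>m\<ge>N. \<forall>n\<ge>N. hnorm X (f m - f n) < e"
  proof (intro exI allI impI)
    fix m n assume "m \<ge> N" "n \<ge> N"
    then show "hnorm X (f m - f n) < e"
      using N[of m] N[of n] hnorm_triangle_diff[of "f m" x "f n"] hnorm_minus_commute[of x "f n"]
        assms by (simp add: hlim_def)
  qed
qed

lemma hCauchy_diff:
  assumes "hCauchy X f" "hCauchy X g"
  shows "hCauchy X (\<lambda>n. f n - g n)"
  unfolding hCauchy_def
proof (intro conjI allI impI)
  show "f n - g n \<in> hcarrier X" for n
    using assms by (simp add: hCauchy_def)
  fix e :: real assume "e > 0"
  then obtain M N where
    M: "\<And>m n. m \<ge> M \<Longrightarrow> n \<ge> M \<Longrightarrow> hnorm X (f m - f n) < e / 2" and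
    N: "\<And>m n. m \<ge> N \<Longrightarrow> n \<ge> N \<Longrightarrow> hnorm X (g m - g n) < e / 2"
    using assms unfolding hCauchy_def by (meson half_gt_zero)
  show "\<exists>N. \<forall>m\<ge>N. \<forall>n\<ge>N. hnorm X (f m - g m - (f n - g n)) < e"
  proof (intro exI allI impI)
    fix m n assume "m \<ge> max M N" "n \<ge> max M N"
    moreover have "hnorm X (f m - g m - (f n - g n)) \<le> hnorm X (f m - f n) + hnorm X (g n - g m)"
      using hnorm_triangle[of "f m - f n" "g n - g m"] assms
      by (simp add: hCauchy_def algebra_simps)
    ultimately show "hnorm X (f m - g m - (f n - g n)) < e"
      using M[of m n] N[of n m] by simp
  qed
qed

lemma hCauchy_uminus: "hCauchy X f \<Longrightarrow> hCauchy X (\<lambda>n. - f n)"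
  using hCauchy_diff[OF hlim_hCauchy[OF hlim_const[OF mem_zero]], of f] by simp

lemma hCauchy_add:
  assumes "hCauchy X f" "hCauchy X g"
  shows "hCauchy X (\<lambda>n. f n + g n)"
  using hCauchy_diff[OF assms(1) hCauchy_uminus[OF assms(2)]] by simp

lemma hCauchy_scale:
  assumes "hCauchy X f"
  shows "hCauchy X (\<lambda>n. hscale X c (f n))"
  unfolding hCauchy_def
proof (intro conjI allI impI)
  show mem: "hscale X c (f n) \<in> hcarrier X" for n
    using assms by (simp add: hCauchy_def)
  fix e :: real assume "e > 0"
  then have "e / (cmod c + 1) > 0"
    by (simp add: add_nonneg_pos)
  then obtain N where
    N: "\<And>m n. m \<ge> N \<Longrightarrow> n \<ge> N \<Longrightarrow> hnorm X (f m - f n) < e / (cmod c + 1)"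
    using assms unfolding hCauchy_def by meson
  show "\<exists>N. \<forall>m\<ge>N. \<forall>n\<ge>N. hnorm X (hscale X c (f m) - hscale X c (f n)) < e"
  proof (intro exI allI impI)
    fix m n assume mn: "m \<ge> N" "n \<ge> N"
    have "hnorm X (hscale X c (f m) - hscale X c (f n)) = cmod c * hnorm X (f m - f n)"
      using assms by (subst hnorm_scale[symmetric]) (auto simp: hCauchy_def scale_right_diff_distrib)
    also have "\<dots> \<le> (cmod c + 1) * hnorm X (f m - f n)"
      using assms by (intro mult_right_mono) (auto simp: hCauchy_def)
    also have "\<dots> < e"
      using N[OF mn] by (simp add: pos_less_divide_eq add_nonneg_pos mult.commute)
    finally show "hnorm X (hscale X c (f m) - hscale X c (f n)) < e" .
  qed
qed

lemma hCauchy_bounded: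
  assumes "hCauchy X f"
  shows "\<exists>B>0. \<forall>n. hnorm X (f n) \<le> B"
proof -
  obtain N where N: "\<And>n. n \<ge> N \<Longrightarrow> hnorm X (f n - f N) < 1"
    using assms unfolding hCauchy_def by (meson zero_less_one order_refl)
  \<comment> \<open>The sum exceeds every early term; the added 1 pays for the distance of the later
    terms from \<open>f N\<close> and makes \<open>B\<close> positive.\<close>
  define B where "B = (\<Sum>i\<le>N. hnorm X (f i)) + 1"
  have mem: "f n \<in> hcarrier X" for n
    using assms by (simp add: hCauchy_def)
  have small: "hnorm X (f n) \<le> B - 1" if "n \<le> N" for n
    using that mem member_le_sum[of n "{..N}" "\<lambda>i. hnorm X (f i)"] unfolding B_def by simp
  have "hnorm X (f n) \<le> B" for n
  proof (cases "n \<le> N")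
    case True
    then show ?thesis using small[of n] by simp
  next
    case False
    then show ?thesis
      using hnorm_triangle[of "f n - f N" "f N"] N[of n] small[of N] mem by simp
  qed
  moreover have "B > 0"
    using small[of 0] hnorm_nonneg[OF mem[of 0]] by simp
  ultimately show ?thesis by blast
qed

text \<open>The other sequence is only required to be Cauchy, hence bounded: in an incomplete space
  it need not have a limit.\<close>

lemma hinner_tendsto_zero:
  assumes f: "\<And>n. f n \<in> hcarrier X" and g: "hCauchy X g"
    and lim: "(\<lambda>n. hnorm X (f n)) \<longlonglongrightarrow> 0"
  shows "(\<lambda>n. hinner X (f n) (g n)) \<longlonglongrightarrow> 0" "(\<lambda>n. hinner X (g n) (f n)) \<longlonglongrightarrow> 0"
proof -
  obtain B where B: "B > 0" "\<And>n. hnorm X (g n) \<le> B"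
    using hCauchy_bounded[OF g] by blast
  have mem: "g n \<in> hcarrier X" for n
    using g by (simp add: hCauchy_def)
  have "cmod (hinner X (f n) (g n)) \<le> hnorm X (f n) * B" for n
    using cauchy_schwarz[OF f mem, of n n] mult_left_mono[OF B(2)[of n] hnorm_nonneg[OF f[of n]]]
    by simp
  moreover have "(\<lambda>n. hnorm X (f n) * B) \<longlonglongrightarrow> 0"
    using tendsto_mult[OF lim tendsto_const[of B]] by simp
  ultimately show *: "(\<lambda>n. hinner X (f n) (g n)) \<longlonglongrightarrow> 0"
    by (rule null_comparison)
  have "(\<lambda>n. cnj (hinner X (f n) (g n))) \<longlonglongrightarrow> cnj 0"
    using * by (rule tendsto_cnj)
  then show "(\<lambda>n. hinner X (g n) (f n)) \<longlonglongrightarrow> 0"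
    using hinner_commute[OF f mem] by simp
qed

text \<open>The completeness used is that of the complex numbers, not of \<open>X\<close>; this is
  what makes the inner product of the completion exist.\<close>

lemma hinner_convergent:
  assumes u: "hCauchy X u" and v: "hCauchy X v"
  shows "convergent (\<lambda>n. hinner X (u n) (v n))"
proof -
  have mem: "u n \<in> hcarrier X" "v n \<in> hcarrier X" for n
    using u v by (simp_all add: hCauchy_def)
  obtain A where A: "A > 0" "\<And>n. hnorm X (u n) \<le> A"
    using hCauchy_bounded[OF u] by blast
  obtain B where B: "B > 0" "\<And>n. hnorm X (v n) \<le> B"
    using hCauchy_bounded[OF v] by blast
  have "Cauchy (\<lambda>n. hinner X (u n) (v n))"
  proof (rule CauchyI)
    fix e :: real assume "e > 0"
    then have "e / (2 * B) > 0" "e / (2 * A) > 0"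
      using A B by simp_all
    then obtain M N where
      M: "\<And>m n. m \<ge> M \<Longrightarrow> n \<ge> M \<Longrightarrow> hnorm X (u m - u n) < e / (2 * B)" and
      N: "\<And>m n. m \<ge> N \<Longrightarrow> n \<ge> N \<Longrightarrow> hnorm X (v m - v n) < e / (2 * A)"
      using u v unfolding hCauchy_def by meson
    have "cmod (hinner X (u m) (v m) - hinner X (u n) (v n)) < e"
      if "m \<ge> max M N" "n \<ge> max M N" for m n
    proof -
      have "hinner X (u m) (v m) - hinner X (u n) (v n) =
          hinner X (u m - u n) (v m) + hinner X (u n) (v m - v n)"
        using mem by (simp add: hinner_diff_left hinner_diff_right)
      also have "cmod \<dots> \<le> cmod (hinner X (u m - u n) (v m)) + cmod (hinner X (u n) (v m - v n))"
        by (rule norm_triangle_ineq)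
      also have "\<dots> \<le> hnorm X (u m - u n) * hnorm X (v m) + hnorm X (u n) * hnorm X (v m - v n)"
        using mem by (intro add_mono cauchy_schwarz) auto
      also have "\<dots> \<le> hnorm X (u m - u n) * B + A * hnorm X (v m - v n)"
        using mem A B by (intro add_mono mult_left_mono mult_right_mono) auto
      also have "hnorm X (u m - u n) * B < e / 2"
        using M[of m n] that B by (simp add: field_simps)
      also have "A * hnorm X (v m - v n) < e / 2"
        using N[of m n] that A by (simp add: field_simps)
      finally show ?thesis by simp
    qed
    then show "\<exists>M. \<forall>m\<ge>M. \<forall>n\<ge>M. cmod (hinner X (u m) (v m) - hinner X (u n) (v n)) < e"
      by blast
  qed
  then show ?thesis
    by (rule Cauchy_convergent)
qed

lemma hinner_tendsto:
  assumes "hlim X f x" "hlim X g y"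
  shows "(\<lambda>n. hinner X (f n) (g n)) \<longlonglongrightarrow> hinner X x y"
proof -
  have mem: "f n \<in> hcarrier X" "g n \<in> hcarrier X" "x \<in> hcarrier X" "y \<in> hcarrier X" for n
    using assms by (simp_all add: hlim_def)
  have "(\<lambda>n. hinner X (f n - x) (g n)) \<longlonglongrightarrow> 0"
    using assms hlim_hCauchy[OF assms(2)] by (intro hinner_tendsto_zero(1)) (auto simp: hlim_def)
  moreover have "(\<lambda>n. hinner X x (g n - y)) \<longlonglongrightarrow> 0"
    using assms hlim_hCauchy[OF hlim_const[OF mem(3)]]
    by (intro hinner_tendsto_zero(2)) (auto simp: hlim_def)
  ultimately have "(\<lambda>n. hinner X (f n - x) (g n) + hinner X x (g n - y) + hinner X x y) \<longlonglongrightarrow>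
      0 + 0 + hinner X x y"
    by (intro tendsto_add tendsto_const)
  then show ?thesis
    using mem by (simp add: hinner_diff_left hinner_diff_right)
qed

end

lemma (in hilbert_space) hlim_unique:
  assumes "hlim X f x" "hlim X f y"
  shows "x = y"
proof -
  have "hlim X (\<lambda>n. 0) (x - y)"
    using hlim_diff[OF assms] by simp
  then have "hnorm X (x - y) = 0"
    using LIMSEQ_unique[of "\<lambda>n. hnorm X (0 - (x - y))" 0 "hnorm X (y - x)"]
      hnorm_minus_commute[of x y] assms
    by (simp add: hlim_def)
  then show ?thesis
    using hnorm_eq_0D[of "x - y"] assms by (simp add: hlim_def)
qed

lemma isometry_hCauchy_iff:
  assumes "semi_inner_space X" "isometry X Y T" "\<And>n. f n \<in> hcarrier X"
  shows "hCauchy Y (\<lambda>n. T (f n)) \<longleftrightarrow> hCauchy X f"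
proof -
  interpret X: semi_inner_space X by fact
  have "hnorm Y (T (f m) - T (f n)) = hnorm X (f m - f n)" for m n
    using isometryD[OF assms(2)] assms(3) linear_op_diff[OF assms(1), of Y T]
    by (metis X.mem_diff)
  then show ?thesis
    using isometryD(2)[OF assms(2)] assms(3) by (simp add: hCauchy_def)
qed

lemma isometry_hlim:
  assumes "semi_inner_space X" "isometry X Y T" "hlim X f x"
  shows "hlim Y (\<lambda>n. T (f n)) (T x)"
proof -
  interpret X: semi_inner_space X by fact
  have "hnorm Y (T (f n) - T x) = hnorm X (f n - x)" for n
    using isometryD[OF assms(2)] assms(3) linear_op_diff[OF assms(1), of Y T]
    by (metis X.mem_diff hlim_def)
  then show ?thesis
    using isometryD(2)[OF assms(2)] assms(3) by (simp add: hlim_def)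
qed

text \<open>The projection theorem for the range of an isometry, with the completeness supplied by the
  domain; it yields both the orthogonal projection onto the range and the adjoint.\<close>

lemma isometry_projection:
  assumes "hilbert_space X" "semi_inner_space Y" and iso: "isometry X Y T" and y: "y \<in> hcarrier Y"
  shows "\<exists>x\<in>hcarrier X. \<forall>x'\<in>hcarrier X. hinner Y (y - T x) (T x') = 0"
proof -
  interpret X: hilbert_space X by fact
  interpret Y: semi_inner_space Y by fact
  note T = linear_opD[OF isometryD(1)[OF iso]]
  note T_diff = linear_op_diff[OF X.semi_inner_space_axioms isometryD(1)[OF iso]]
  define Q where "Q = (\<lambda>x. (hnorm Y (y - T x))\<^sup>2) ` hcarrier X"
  define d where "d = Inf Q"
  have bdd: "bdd_below Q"
    unfolding Q_def by (rule bdd_belowI[of _ 0]) auto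
  have ne: "Q \<noteq> {}"
    unfolding Q_def using X.mem_zero by blast
  have d_le: "d \<le> (hnorm Y (y - T x))\<^sup>2" if "x \<in> hcarrier X" for x
    unfolding d_def by (rule cInf_lower[OF _ bdd]) (use that in \<open>auto simp: Q_def\<close>)
  have "\<exists>x\<in>hcarrier X. (hnorm Y (y - T x))\<^sup>2 < d + inverse (real (Suc n))" for n
  proof -
    have "Inf Q < d + inverse (real (Suc n))"
      unfolding d_def[symmetric] by simp
    from cInf_lessD[OF ne this] show ?thesis
      unfolding Q_def by blast
  qed
  then obtain f where f: "\<And>n. f n \<in> hcarrier X"
    and f_lt: "\<And>n. (hnorm Y (y - T (f n)))\<^sup>2 < d + inverse (real (Suc n))"
    by metis
  \<comment> \<open>The midpoint of \<open>f m\<close> and \<open>f n\<close> competes for the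
    minimum as well, so its squared distance to y is at least d. The parallelogram law then bounds
    the difference of the two images, and the isometry carries the bound back to \<open>X\<close>,
    where completeness is available.\<close>
  have f_close: "(hnorm X (f m - f n))\<^sup>2 \<le> 2 * (inverse (real (Suc m)) + inverse (real (Suc n)))" for m n
  proof -
    let ?mid = "hscale X (1/2) (f m + f n)"
    have "hscale Y 2 (y - T ?mid) = (y - T (f m)) + (y - T (f n))"
    proof -
      have "hscale Y 2 y = y + y"
        using Y.scale_left_distrib[of 1 1 y] by simp
      moreover have "hscale Y 2 (T ?mid) = T (f m) + T (f n)"
        using f by (simp add: T)
      ultimately show ?thesis
        by (simp add: Y.scale_right_diff_distrib algebra_simps)
    qed
    then have "(hnorm Y ((y - T (f m)) + (y - T (f n))))\<^sup>2 = 4 * (hnorm Y (y - T ?mid))\<^sup>2"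
      using y f by (subst \<open>hscale Y 2 _ = _\<close>[symmetric], subst Y.hnorm_scale)
        (auto simp: T power_mult_distrib)
    then have mid: "4 * d \<le> (hnorm Y ((y - T (f m)) + (y - T (f n))))\<^sup>2"
      using d_le[of ?mid] f by simp
    have "hnorm Y ((y - T (f m)) - (y - T (f n))) = hnorm X (f m - f n)"
      using isometryD(3)[OF iso, of "f n - f m"] f X.hnorm_minus_commute[of "f m" "f n"]
      by (simp add: T_diff)
    then have "(hnorm X (f m - f n))\<^sup>2 =
        2 * (hnorm Y (y - T (f m)))\<^sup>2 + 2 * (hnorm Y (y - T (f n)))\<^sup>2
          - (hnorm Y ((y - T (f m)) + (y - T (f n))))\<^sup>2"
      using Y.parallelogram[of "y - T (f m)" "y - T (f n)"] y f by (simp add: T)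
    then show ?thesis
      using mid f_lt[of m] f_lt[of n] by (simp add: algebra_simps)
  qed
  have "hCauchy X f"
    unfolding hCauchy_def
  proof (intro conjI allI impI f)
    fix e :: real assume "e > 0"
    then have "e\<^sup>2 / 4 > 0" by simp
    then obtain N where N: "inverse (real (Suc N)) < e\<^sup>2 / 4"
      using reals_Archimedean by blast
    show "\<exists>N. \<forall>m\<ge>N. \<forall>n\<ge>N. hnorm X (f m - f n) < e"
    proof (intro exI allI impI)
      fix m n assume mn: "m \<ge> N" "n \<ge> N"
      define r where "r k = inverse (real (Suc k))" for k
      have "r m \<le> r N" "r n \<le> r N" "r N < e\<^sup>2 / 4"
        using mn N by (simp_all add: r_def field_simps)
      then have "2 * (r m + r n) < e\<^sup>2"
        by simp
      then have "(hnorm X (f m - f n))\<^sup>2 < e\<^sup>2"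
        using f_close[of m n, folded r_def] by (rule le_less_trans[rotated])
      then show "hnorm X (f m - f n) < e"
        using \<open>e > 0\<close> power2_less_imp_less[of "hnorm X (f m - f n)" e] by simp
    qed
  qed
  then obtain x where x: "hlim X f x"
    using X.hCauchy_converges by blast
  then have xX: "x \<in> hcarrier X"
    by (simp add: hlim_def)
  have lim: "hlim Y (\<lambda>n. y - T (f n)) (y - T x)"
    using isometry_hlim[OF X.semi_inner_space_axioms iso x] Y.hlim_const[OF y] Y.hlim_diff by blast
  have "(\<lambda>n. Re (hinner Y (y - T (f n)) (y - T (f n)))) \<longlonglongrightarrow> Re (hinner Y (y - T x) (y - T x))"
    using Y.hinner_tendsto[OF lim lim] by (rule tendsto_Re)
  then have "(\<lambda>n. (hnorm Y (y - T (f n)))\<^sup>2) \<longlonglongrightarrow> (hnorm Y (y - T x))\<^sup>2"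
    using y f xX by (simp add: Y.hinner_self T)
  moreover have "(\<lambda>n. d + inverse (real (Suc n))) \<longlonglongrightarrow> d"
    using tendsto_add[OF tendsto_const[of d] LIMSEQ_inverse_real_of_nat] by simp
  ultimately have min: "(hnorm Y (y - T x))\<^sup>2 \<le> d"
    using f_lt less_imp_le by (intro LIMSEQ_le) blast+
  define z where "z = y - T x"
  have z: "z \<in> hcarrier Y"
    using y xX by (simp add: z_def T)
  have "hinner Y z (T x') = 0" if x': "x' \<in> hcarrier X" for x'
  proof -
    let ?b = "(cmod (hinner Y z (T x')))\<^sup>2"
    \<comment> \<open>Moving x in the direction of x' cannot bring its image closer to y. The factor
      \<open>hinner Y z (T x')\<close> makes the first-order term real.\<close>
    have quad: "2 * t * ?b \<le> t\<^sup>2 * ?b * (hnorm Y (T x'))\<^sup>2" for t :: real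
    proof -
      let ?w = "complex_of_real t * hinner Y z (T x')"
      have "(hnorm Y z)\<^sup>2 \<le> (hnorm Y (y - T (x + hscale X ?w x')))\<^sup>2"
        using min d_le[of "x + hscale X ?w x'"] xX x' by (simp add: z_def)
      also have "y - T (x + hscale X ?w x') = z - hscale Y ?w (T x')"
        using xX x' by (simp add: z_def T)
      also have "(hnorm Y \<dots>)\<^sup>2 =
          (hnorm Y z)\<^sup>2 - 2 * Re (cnj ?w * hinner Y z (T x')) + (cmod ?w)\<^sup>2 * (hnorm Y (T x'))\<^sup>2"
        using z x' by (simp add: Y.hnorm_diff_sq Y.hinner_scale_right Y.hnorm_scale T
            power_mult_distrib)
      also have "cnj ?w * hinner Y z (T x') = complex_of_real (t * ?b)"
        unfolding of_real_mult complex_norm_square by simp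
      also have "(cmod ?w)\<^sup>2 = t\<^sup>2 * ?b"
        by (simp add: norm_mult power_mult_distrib)
      finally show ?thesis
        by simp
    qed
    let ?c = "(hnorm Y (T x'))\<^sup>2"
    have "?b \<le> 0"
    proof (cases "?c = 0")
      case True
      then show ?thesis using quad[of 1] by simp
    next
      case False
      \<comment> \<open>At \<open>1 / ?c\<close> the quadratic term is half of the linear
        one.\<close>
      then have "2 * ?b \<le> ?b"
        using quad[of "1 / ?c"] by (simp add: power2_eq_square divide_simps split: if_splits)
      then show ?thesis by simp
    qed
    then show ?thesis by simp
  qed
  with xX show ?thesis
    unfolding z_def by blast
qed

section \<open>Functional completion\<close>

lemma (in semi_inner_space) hilbert_spaceI:
  assumes "\<And>x. \<lbrakk>x \<in> hcarrier X; hinner X x x = 0\<rbrakk> \<Longrightarrow> x = 0"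
    and "\<And>f. hCauchy X f \<Longrightarrow> \<exists>x. hlim X f x"
  shows "hilbert_space X"
proof unfold_locales
  fix f :: "nat \<Rightarrow> 'a"
  assume "\<And>n. f n \<in> hcarrier X"
    and "\<And>e. e > 0 \<Longrightarrow> \<exists>N::nat. \<forall>m\<ge>N. \<forall>n\<ge>N. hnorm X (f m - f n) < e"
  then have "hCauchy X f"
    unfolding hCauchy_def by blast
  then show "\<exists>x\<in>hcarrier X. (\<lambda>n. hnorm X (f n - x)) \<longlonglongrightarrow> 0"
    using assms(2) by (auto simp: hlim_def)
qed (fact assms(1) subspace_hcarrier hinner_add_left hinner_scale_left hinner_commute
      hinner_self_nonneg)+

text \<open>The functional completion of Aronszajn: the abstract completion of a semi-inner product space
  \<open>D\<close> is realised by functions \<open>'i \<Rightarrow> 'h\<close>, as pointwise limits of the functions \<open>p (u n)\<close> along Cauchy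
  sequences \<open>u\<close> in \<open>D\<close>. The assumption \<open>separating\<close> says that such a limit determines \<open>u\<close> up to a
  null sequence.\<close>

locale functional_completion =
  D: semi_inner_space D + H: hilbert_space H
  for D :: "'d::ab_group_add hspace" and H :: "'h::ab_group_add hspace" +
  fixes p :: "'d \<Rightarrow> 'i \<Rightarrow> 'h" and C :: "'i \<Rightarrow> real"
  assumes p_mem: "u \<in> hcarrier D \<Longrightarrow> p u \<sigma> \<in> hcarrier H"
    and p_add: "u \<in> hcarrier D \<Longrightarrow> v \<in> hcarrier D \<Longrightarrow> p (u + v) \<sigma> = p u \<sigma> + p v \<sigma>"
    and p_scale: "u \<in> hcarrier D \<Longrightarrow> p (hscale D c u) \<sigma> = hscale H c (p u \<sigma>)"
    and p_bound: "u \<in> hcarrier D \<Longrightarrow> hnorm H (p u \<sigma>) \<le> C \<sigma> * hnorm D u"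
    and separating: "(\<And>n. w n \<in> hcarrier D) \<Longrightarrow> v \<in> hcarrier D \<Longrightarrow>
      (\<And>\<sigma>. (\<lambda>n. hnorm H (p (w n) \<sigma>)) \<longlonglongrightarrow> 0) \<Longrightarrow> (\<lambda>n. hinner D (w n) v) \<longlonglongrightarrow> 0"
begin

lemma p_diff: "u \<in> hcarrier D \<Longrightarrow> v \<in> hcarrier D \<Longrightarrow> p (u - v) \<sigma> = p u \<sigma> - p v \<sigma>"
  using p_add[of "u - v" v \<sigma>] by simp

lemma p_hCauchy:
  assumes "hCauchy D u"
  shows "hCauchy H (\<lambda>n. p (u n) \<sigma>)"
  unfolding hCauchy_def
proof (intro conjI allI impI)
  have u: "u n \<in> hcarrier D" for n
    using assms by (simp add: hCauchy_def)
  then show "p (u n) \<sigma> \<in> hcarrier H" for n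
    by (rule p_mem)
  fix e :: real assume e: "e > 0"
  \<comment> \<open>\<open>C \<sigma>\<close> may be zero or negative, and a positive divisor is
    needed.\<close>
  let ?C = "\<bar>C \<sigma>\<bar> + 1"
  have "e / ?C > 0"
    using e by (simp add: add_nonneg_pos)
  then obtain N where N: "\<And>m n. m \<ge> N \<Longrightarrow> n \<ge> N \<Longrightarrow> hnorm D (u m - u n) < e / ?C"
    using assms unfolding hCauchy_def by meson
  show "\<exists>N. \<forall>m\<ge>N. \<forall>n\<ge>N. hnorm H (p (u m) \<sigma> - p (u n) \<sigma>) < e"
  proof (intro exI allI impI)
    fix m n assume mn: "m \<ge> N" "n \<ge> N"
    have "hnorm H (p (u m) \<sigma> - p (u n) \<sigma>) \<le> C \<sigma> * hnorm D (u m - u n)"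
      using p_bound[of "u m - u n" \<sigma>] u by (simp add: p_diff)
    also have "\<dots> \<le> ?C * hnorm D (u m - u n)"
      using u by (intro mult_right_mono) auto
    also have "\<dots> < e"
      using N[OF mn] by (simp add: pos_less_divide_eq add_nonneg_pos mult.commute)
    finally show "hnorm H (p (u m) \<sigma> - p (u n) \<sigma>) < e" .
  qed
qed

definition represents :: "(nat \<Rightarrow> 'd) \<Rightarrow> ('i \<Rightarrow> 'h) \<Rightarrow> bool"
  where "represents u f \<longleftrightarrow> hCauchy D u \<and> (\<forall>\<sigma>. hlim H (\<lambda>n. p (u n) \<sigma>) (f \<sigma>))"

lemma represents_add:
  assumes "represents u f" "represents v g"
  shows "represents (\<lambda>n. u n + v n) (f + g)"
proof -
  have "u n \<in> hcarrier D" "v n \<in> hcarrier D" for n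
    using assms by (simp_all add: represents_def hCauchy_def)
  then show ?thesis
    using assms by (simp add: represents_def D.hCauchy_add p_add H.hlim_add)
qed

lemma represents_scale:
  assumes "represents u f"
  shows "represents (\<lambda>n. hscale D c (u n)) (\<lambda>\<sigma>. hscale H c (f \<sigma>))"
proof -
  have "u n \<in> hcarrier D" for n
    using assms by (simp add: represents_def hCauchy_def)
  then show ?thesis
    using assms by (simp add: represents_def D.hCauchy_scale p_scale H.hlim_scale)
qed

lemma represents_const: "u \<in> hcarrier D \<Longrightarrow> represents (\<lambda>n. u) (p u)"
  by (simp add: represents_def D.hlim_hCauchy[OF D.hlim_const] H.hlim_const p_mem)

lemma represents_exists: "hCauchy D u \<Longrightarrow> \<exists>f. represents u f"
  using H.hCauchy_converges[OF p_hCauchy] unfolding represents_def by metis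

text \<open>Write the square of the norm of \<open>u n\<close> as the sum of its inner products with
  \<open>u n - u N\<close> and with \<open>u N\<close>. The first is small by the Cauchy property
  once N is large; the second tends to 0 by \<open>separating\<close>, because \<open>u N\<close>
  stays fixed.\<close>

lemma null_if_pointwise_null:
  assumes u: "hCauchy D u" and null: "\<And>\<sigma>. (\<lambda>n. hnorm H (p (u n) \<sigma>)) \<longlonglongrightarrow> 0"
  shows "(\<lambda>n. hnorm D (u n)) \<longlonglongrightarrow> 0"
proof (rule LIMSEQ_I)
  fix r :: real assume r: "r > 0"
  have mem: "u n \<in> hcarrier D" for n
    using u by (simp add: hCauchy_def)
  obtain B where B: "B > 0" "\<And>n. hnorm D (u n) \<le> B"
    using D.hCauchy_bounded[OF u] by blast
  have "r\<^sup>2 / (2 * B) > 0"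
    using r B by simp
  then obtain N where N: "\<And>m n. m \<ge> N \<Longrightarrow> n \<ge> N \<Longrightarrow> hnorm D (u m - u n) < r\<^sup>2 / (2 * B)"
    using u unfolding hCauchy_def by meson
  have "(\<lambda>n. hinner D (u n) (u N)) \<longlonglongrightarrow> 0"
    using separating[OF mem mem null] .
  then obtain M where M: "\<And>n. n \<ge> M \<Longrightarrow> cmod (hinner D (u n) (u N)) < r\<^sup>2 / 2"
    using LIMSEQ_D[of _ 0 "r\<^sup>2 / 2"] r by (metis diff_zero half_gt_zero zero_less_power)
  show "\<exists>no. \<forall>n\<ge>no. norm (hnorm D (u n) - 0) < r"
  proof (intro exI allI impI)
    fix n assume n: "n \<ge> max M N"
    have "(hnorm D (u n))\<^sup>2 = cmod (hinner D (u n) (u n))"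
      using mem by (simp add: D.hinner_self norm_power)
    also have "hinner D (u n) (u n) = hinner D (u n) (u n - u N) + hinner D (u n) (u N)"
      using mem by (simp add: D.hinner_diff_right)
    also have "cmod \<dots> \<le> cmod (hinner D (u n) (u n - u N)) + cmod (hinner D (u n) (u N))"
      by (rule norm_triangle_ineq)
    also have "cmod (hinner D (u n) (u n - u N)) \<le> hnorm D (u n) * hnorm D (u n - u N)"
      using mem by (intro D.cauchy_schwarz) auto
    also have "hnorm D (u n) * hnorm D (u n - u N) \<le> B * hnorm D (u n - u N)"
      using mem B by (intro mult_right_mono) auto
    also have "B * hnorm D (u n - u N) < r\<^sup>2 / 2"
      using N[of n N] n B by (simp add: field_simps)
    also have "cmod (hinner D (u n) (u N)) < r\<^sup>2 / 2"
      using M n by simp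
    finally have "(hnorm D (u n))\<^sup>2 < r\<^sup>2"
      by simp
    then show "norm (hnorm D (u n) - 0) < r"
      using r mem power2_less_imp_less[of "hnorm D (u n)" r] by simp
  qed
qed

lemma represents_unique_null:
  assumes "represents u f" "represents v f"
  shows "(\<lambda>n. hnorm D (u n - v n)) \<longlonglongrightarrow> 0"
proof (rule null_if_pointwise_null)
  show "hCauchy D (\<lambda>n. u n - v n)"
    using assms by (simp add: represents_def D.hCauchy_diff)
  have mem: "u n \<in> hcarrier D" "v n \<in> hcarrier D" for n
    using assms by (simp_all add: represents_def hCauchy_def)
  show "(\<lambda>n. hnorm H (p (u n - v n) \<sigma>)) \<longlonglongrightarrow> 0" for \<sigma>
    using H.hlim_diff[of "\<lambda>n. p (u n) \<sigma>" "f \<sigma>" "\<lambda>n. p (v n) \<sigma>" "f \<sigma>"] assms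
    by (simp add: represents_def hlim_def p_diff[OF mem])
qed

text \<open>The representing sequences are picked by choice; that any others give the same limit is
  shown next.\<close>

definition limit_inner :: "('i \<Rightarrow> 'h) \<Rightarrow> ('i \<Rightarrow> 'h) \<Rightarrow> complex"
  where "limit_inner f g = lim (\<lambda>n. hinner D ((SOME u. represents u f) n) ((SOME v. represents v g) n))"

text \<open>Two sequences that represent the same function differ by a null sequence, so u and v can
  be exchanged for the chosen ones one after the other.\<close>

lemma limit_inner:
  assumes u: "represents u f" and v: "represents v g"
  shows "(\<lambda>n. hinner D (u n) (v n)) \<longlonglongrightarrow> limit_inner f g"
proof -
  define u' v' where "u' = (SOME u. represents u f)" and "v' = (SOME v. represents v g)"
  have u': "represents u' f" and v': "represents v' g"
    unfolding u'_def v'_def using u v by (metis someI)+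
  have cauchy: "hCauchy D u" "hCauchy D v" "hCauchy D u'" "hCauchy D v'"
    using u v u' v' by (simp_all add: represents_def)
  have mem: "u n \<in> hcarrier D" "v n \<in> hcarrier D" "u' n \<in> hcarrier D" "v' n \<in> hcarrier D" for n
    using cauchy by (simp_all add: hCauchy_def)
  have "(\<lambda>n. hinner D (u' n) (v' n)) \<longlonglongrightarrow> limit_inner f g"
    unfolding limit_inner_def u'_def[symmetric] v'_def[symmetric]
    using D.hinner_convergent cauchy convergent_LIMSEQ_iff by blast
  moreover have "(\<lambda>n. hinner D (u n - u' n) (v n)) \<longlonglongrightarrow> 0"
    using represents_unique_null[OF u u'] cauchy mem by (intro D.hinner_tendsto_zero) auto
  moreover have "(\<lambda>n. hinner D (u' n) (v n - v' n)) \<longlonglongrightarrow> 0"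
    using represents_unique_null[OF v v'] cauchy mem by (intro D.hinner_tendsto_zero) auto
  ultimately have "(\<lambda>n. hinner D (u' n) (v' n) + hinner D (u n - u' n) (v n)
      + hinner D (u' n) (v n - v' n)) \<longlonglongrightarrow> limit_inner f g + 0 + 0"
    by (intro tendsto_add)
  then show ?thesis
    using mem by (simp add: D.hinner_diff_left D.hinner_diff_right)
qed

definition completion :: "('i \<Rightarrow> 'h) hspace"
  where "completion =
    \<lparr>hcarrier = {f. \<exists>u. represents u f}, hscale = (\<lambda>c f \<sigma>. hscale H c (f \<sigma>)), hinner = limit_inner\<rparr>"

lemma completion_simps [simp]:
  "f \<in> hcarrier completion \<longleftrightarrow> (\<exists>u. represents u f)"
  "hscale completion c f = (\<lambda>\<sigma>. hscale H c (f \<sigma>))"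
  "hinner completion f g = limit_inner f g"
  by (simp_all add: completion_def)

lemma vector_space_completion: "vector_space (hscale completion)"
  by unfold_locales
    (simp_all add: fun_eq_iff H.scale_right_distrib H.scale_left_distrib)

text \<open>Every law holds in \<open>D\<close> term by term along representing sequences and passes
  to the limit. The freedom in the choice of representatives lets a sum or a multiple be represented
  termwise.\<close>

lemma semi_inner_space_completion: "semi_inner_space completion"
proof -
  interpret V: vector_space "hscale completion"
    by (rule vector_space_completion)
  show ?thesis
  proof unfold_locales
    show "V.subspace (hcarrier completion)"
    proof (rule V.subspaceI)
      have "represents (\<lambda>n. 0) (\<lambda>\<sigma>. hscale H 0 (p 0 \<sigma>))"
        using represents_scale[OF represents_const[OF D.mem_zero], of 0] by simp
      then have "represents (\<lambda>n. 0) 0"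
        by (simp add: zero_fun_def)
      then show "0 \<in> hcarrier completion"
        by auto
    qed (auto intro: represents_add represents_scale)
  next
    fix f g h assume "f \<in> hcarrier completion" "g \<in> hcarrier completion" "h \<in> hcarrier completion"
    then obtain u v w where uvw: "represents u f" "represents v g" "represents w h"
      by auto
    have mem: "u n \<in> hcarrier D" "v n \<in> hcarrier D" "w n \<in> hcarrier D" for n
      using uvw by (simp_all add: represents_def hCauchy_def)
    have "(\<lambda>n. hinner D (u n + v n) (w n)) \<longlonglongrightarrow> limit_inner (f + g) h"
      by (intro limit_inner represents_add uvw)
    moreover have "(\<lambda>n. hinner D (u n) (w n) + hinner D (v n) (w n)) \<longlonglongrightarrow>
        limit_inner f h + limit_inner g h"
      by (intro tendsto_add limit_inner uvw)
    ultimately show "hinner completion (f + g) h = hinner completion f h + hinner completion g h"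
      using mem LIMSEQ_unique by (simp add: D.hinner_add_left) blast
  next
    fix f g c assume "f \<in> hcarrier completion" "g \<in> hcarrier completion"
    then obtain u v where uv: "represents u f" "represents v g"
      by auto
    have mem: "u n \<in> hcarrier D" "v n \<in> hcarrier D" for n
      using uv by (simp_all add: represents_def hCauchy_def)
    have "(\<lambda>n. hinner D (hscale D c (u n)) (v n)) \<longlonglongrightarrow> limit_inner (\<lambda>\<sigma>. hscale H c (f \<sigma>)) g"
      by (intro limit_inner represents_scale uv)
    moreover have "(\<lambda>n. c * hinner D (u n) (v n)) \<longlonglongrightarrow> c * limit_inner f g"
      by (intro tendsto_mult tendsto_const limit_inner uv)
    ultimately show "hinner completion (hscale completion c f) g = c * hinner completion f g"
      using mem LIMSEQ_unique by (simp add: D.hinner_scale_left) blast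
    have "(\<lambda>n. cnj (hinner D (u n) (v n))) \<longlonglongrightarrow> cnj (limit_inner f g)"
      by (intro tendsto_cnj limit_inner uv)
    moreover have "cnj (hinner D (u n) (v n)) = hinner D (v n) (u n)" for n
      using D.hinner_commute[OF mem] by simp
    ultimately show "hinner completion g f = cnj (hinner completion f g)"
      using limit_inner[OF uv(2) uv(1)] LIMSEQ_unique by simp blast
  next
    fix f assume "f \<in> hcarrier completion"
    then obtain u where u: "represents u f"
      by auto
    then have "hinner D (u n) (u n) \<in> \<real>\<^sub>\<ge>\<^sub>0" for n
      by (simp add: represents_def hCauchy_def D.hinner_self_nonneg)
    then have nonneg: "0 \<le> Re (hinner D (u n) (u n))" "Im (hinner D (u n) (u n)) = 0" for n
      by (simp_all add: complex_nonneg_Reals_iff)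
    have "0 \<le> Re (limit_inner f f)"
      using tendsto_Re[OF limit_inner[OF u u]] nonneg(1) LIMSEQ_le_const by blast
    moreover have "Im (limit_inner f f) = 0"
      using tendsto_Im[OF limit_inner[OF u u]] by (simp add: nonneg(2) LIMSEQ_const_iff)
    ultimately show "hinner completion f f \<in> \<real>\<^sub>\<ge>\<^sub>0"
      by (simp add: complex_nonneg_Reals_iff)
  qed
qed

sublocale X: semi_inner_space completion
  by (rule semi_inner_space_completion)

lemma p_isometry: "isometry D completion p"
proof (rule isometryI)
  show "linear_op D completion p"
    unfolding linear_op_def using represents_const by (auto simp: fun_eq_iff p_add p_scale)
  fix u assume "u \<in> hcarrier D"
  then have "(\<lambda>n. hinner D u u) \<longlonglongrightarrow> limit_inner (p u) (p u)"
    using limit_inner[OF represents_const represents_const] by blast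
  then show "hinner completion (p u) (p u) = hinner D u u"
    by (simp add: LIMSEQ_const_iff)
qed

text \<open>For fixed n, \<open>p (u n) - f\<close> is represented by the sequence of the
  \<open>u n - u m\<close> in m, so its norm is the limit over m of their norms, which is small for
  large n. Hence the image of \<open>D\<close> is dense.\<close>

lemma represents_hlim:
  assumes u: "represents u f"
  shows "hlim completion (\<lambda>n. p (u n)) f"
proof -
  have cauchy: "hCauchy D u" and mem: "u n \<in> hcarrier D" for n
    using u by (simp_all add: represents_def hCauchy_def)
  have f: "f \<in> hcarrier completion" and p: "p (u n) \<in> hcarrier completion" for n
    using u represents_const[OF mem] by auto
  have rep: "represents (\<lambda>m. u n - u m) (p (u n) - f)" for n
    using represents_add[OF represents_const[OF mem, of n] represents_scale[OF u, of "-1"]]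
    by (simp add: fun_diff_def plus_fun_def)
  have "(\<lambda>n. hnorm completion (p (u n) - f)) \<longlonglongrightarrow> 0"
  proof (rule LIMSEQ_I)
    fix r :: real assume r: "r > 0"
    then obtain N where N: "\<And>m n. m \<ge> N \<Longrightarrow> n \<ge> N \<Longrightarrow> hnorm D (u m - u n) < r / 2"
      using cauchy half_gt_zero unfolding hCauchy_def by meson
    show "\<exists>no. \<forall>n\<ge>no. norm (hnorm completion (p (u n) - f) - 0) < r"
    proof (intro exI allI impI)
      fix n assume n: "n \<ge> N"
      have "(\<lambda>m. sqrt (Re (hinner D (u n - u m) (u n - u m)))) \<longlonglongrightarrow> hnorm completion (p (u n) - f)"
        unfolding hnorm_def completion_simps
        by (intro tendsto_real_sqrt tendsto_Re limit_inner rep)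
      then have "(\<lambda>m. hnorm D (u n - u m)) \<longlonglongrightarrow> hnorm completion (p (u n) - f)"
        by (simp add: hnorm_def)
      moreover have "\<forall>m\<ge>N. hnorm D (u n - u m) \<le> r / 2"
        using N[OF n] less_imp_le by blast
      ultimately have "hnorm completion (p (u n) - f) \<le> r / 2"
        using LIMSEQ_le_const2 by blast
      then show "norm (hnorm completion (p (u n) - f) - 0) < r"
        using r X.hnorm_nonneg[OF X.mem_diff[OF p f], of n] by simp
    qed
  qed
  with f p show ?thesis
    by (simp add: hlim_def)
qed

lemma hilbert_space_completion: "hilbert_space completion"
proof (rule X.hilbert_spaceI)
  fix f assume f: "f \<in> hcarrier completion" and 0: "hinner completion f f = 0"
  then obtain u where u: "represents u f"
    by auto
  then have mem: "u n \<in> hcarrier D" for n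
    by (simp add: represents_def hCauchy_def)
  have "(\<lambda>n. sqrt (Re (hinner D (u n) (u n)))) \<longlonglongrightarrow> sqrt (Re (limit_inner f f))"
    by (intro tendsto_real_sqrt tendsto_Re limit_inner u)
  then have null: "(\<lambda>n. hnorm D (u n)) \<longlonglongrightarrow> 0"
    using 0 by (simp add: hnorm_def)
  \<comment> \<open>A representing sequence of f is null, and the bound on the evaluations turns
    this into pointwise convergence to 0.\<close>
  show "f = 0"
  proof
    fix \<sigma>
    have "(\<lambda>n. C \<sigma> * hnorm D (u n)) \<longlonglongrightarrow> 0"
      using tendsto_mult[OF tendsto_const[of "C \<sigma>"] null] by simp
    then have "(\<lambda>n. hnorm H (p (u n) \<sigma>)) \<longlonglongrightarrow> 0"
      using p_bound[OF mem] mem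
      by (elim null_comparison[rotated]) (simp add: p_mem)
    then have "hlim H (\<lambda>n. p (u n) \<sigma>) 0"
      using mem by (simp add: hlim_def p_mem)
    then show "f \<sigma> = 0 \<sigma>"
      using u H.hlim_unique unfolding represents_def by (simp add: zero_fun_def) blast
  qed
next
  fix F :: "nat \<Rightarrow> 'i \<Rightarrow> 'h"
  assume cauchy: "hCauchy completion F"
  then have F: "F n \<in> hcarrier completion" for n
    by (simp add: hCauchy_def)
  note p_linear = isometryD(1)[OF p_isometry]
  \<comment> \<open>Replacing \<open>F n\<close> by a nearby \<open>p (u n)\<close> keeps the
    sequence Cauchy. Since p is isometric, u is then Cauchy in \<open>D\<close>, and the function it
    represents is the limit sought.\<close>
  have "\<exists>u\<in>hcarrier D. hnorm completion (F n - p u) < inverse (real (Suc n))" for n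
  proof -
    obtain v where v: "represents v (F n)"
      using F[of n] by auto
    then have mem: "v k \<in> hcarrier D" for k
      by (simp add: represents_def hCauchy_def)
    obtain k where "hnorm completion (p (v k) - F n) < inverse (real (Suc n))"
      using represents_hlim[OF v] LIMSEQ_D[of "\<lambda>k. hnorm completion (p (v k) - F n)" 0
          "inverse (real (Suc n))"]
      unfolding hlim_def by (auto simp: abs_less_iff)
    moreover have "hnorm completion (p (v k) - F n) = hnorm completion (F n - p (v k))"
      using F linear_opD(1)[OF p_linear mem] by (intro X.hnorm_minus_commute)
    ultimately show ?thesis
      using mem by metis
  qed
  then obtain u where u: "\<And>n. u n \<in> hcarrier D"
    and close: "\<And>n. hnorm completion (F n - p (u n)) < inverse (real (Suc n))"
    by metis
  have pu: "p (u n) \<in> hcarrier completion" for n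
    using linear_opD(1)[OF p_linear u] .
  have lim0: "hlim completion (\<lambda>n. F n - p (u n)) 0"
    unfolding hlim_def
  proof (intro conjI allI X.mem_zero X.mem_diff F pu)
    show "(\<lambda>n. hnorm completion (F n - p (u n) - 0)) \<longlonglongrightarrow> 0"
      using close X.hnorm_nonneg[OF X.mem_diff[OF F pu]]
      by (intro null_comparison[OF _ LIMSEQ_inverse_real_of_nat]) (simp add: less_imp_le del: of_nat_Suc)
  qed
  have "hCauchy completion (\<lambda>n. F n - (F n - p (u n)))"
    using cauchy X.hlim_hCauchy[OF lim0] by (rule X.hCauchy_diff)
  then have "hCauchy D u"
    using isometry_hCauchy_iff[OF D.semi_inner_space_axioms p_isometry u] by simp
  then obtain f where "represents u f"
    using represents_exists by blast
  then have "hlim completion (\<lambda>n. (F n - p (u n)) + p (u n)) (0 + f)"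
    by (intro X.hlim_add lim0 represents_hlim)
  then show "\<exists>f. hlim completion F f"
    by auto
qed

lemma completion_dense: "f \<in> hcarrier completion \<Longrightarrow> \<exists>u. (\<forall>n. u n \<in> hcarrier D) \<and> hlim completion (\<lambda>n. p (u n)) f"
  using represents_hlim by (auto simp: represents_def hCauchy_def)

end

text \<open>\<open>D\<close> is in general only semi-normed, and \<open>P\<close> its map to a dense subspace of \<open>X\<close>.\<close>

lemma isometry_extension:
  assumes "semi_inner_space D" "hilbert_space X" "hilbert_space Y"
    and P: "isometry D X P" and Q: "isometry D Y Q"
    and dense: "\<And>x. x \<in> hcarrier X \<Longrightarrow> \<exists>u. (\<forall>n. u n \<in> hcarrier D) \<and> hlim X (\<lambda>n. P (u n)) x"
  shows "\<exists>T. isometry X Y T \<and> (\<forall>u\<in>hcarrier D. T (P u) = Q u)"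
proof -
  interpret D: semi_inner_space D by fact
  interpret X: hilbert_space X by fact
  interpret Y: hilbert_space Y by fact
  note P' = linear_opD[OF isometryD(1)[OF P]] and Q' = linear_opD[OF isometryD(1)[OF Q]]
  note diff = linear_op_diff[OF D.semi_inner_space_axioms isometryD(1)[OF P]]
    linear_op_diff[OF D.semi_inner_space_axioms isometryD(1)[OF Q]]
  define appr where "appr x u \<longleftrightarrow> (\<forall>n. u n \<in> hcarrier D) \<and> hlim X (\<lambda>n. P (u n)) x" for x u
  \<comment> \<open>The future value \<open>T x\<close>. Letting u range over all approximations of
    x makes y independent of the approximation, so that \<open>T\<close> can be evaluated along sums
    and multiples of sequences. The independence holds because \<open>P\<close> and \<open>Q\<close>
    give differences the same norm.\<close>
  have ex: "\<exists>y. \<forall>u. appr x u \<longrightarrow> hlim Y (\<lambda>n. Q (u n)) y" if x: "x \<in> hcarrier X" for x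
  proof -
    obtain u where u: "appr x u"
      using dense[OF x] appr_def by blast
    then have "hCauchy D u"
      using isometry_hCauchy_iff[OF D.semi_inner_space_axioms P, of u] X.hlim_hCauchy
      by (auto simp: appr_def)
    then have "hCauchy Y (\<lambda>n. Q (u n))"
      using isometry_hCauchy_iff[OF D.semi_inner_space_axioms Q, of u] by (simp add: hCauchy_def)
    then obtain y where y: "hlim Y (\<lambda>n. Q (u n)) y"
      using Y.hCauchy_converges by blast
    have "hlim Y (\<lambda>n. Q (v n)) y" if v: "appr x v" for v
    proof -
      have mem: "u n \<in> hcarrier D" "v n \<in> hcarrier D" for n
        using u v by (simp_all add: appr_def)
      have "hlim X (\<lambda>n. P (v n) - P (u n)) (x - x)"
        using u v by (intro X.hlim_diff) (auto simp: appr_def)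
      moreover have "hnorm X (P (v n) - P (u n)) = hnorm Y (Q (v n) - Q (u n))" for n
        using mem isometryD(3)[OF P, of "v n - u n"] isometryD(3)[OF Q, of "v n - u n"]
        by (simp add: diff)
      ultimately have "hlim Y (\<lambda>n. Q (v n) - Q (u n)) 0"
        using mem by (simp add: hlim_def Q')
      then have "hlim Y (\<lambda>n. Q (v n) - Q (u n) + Q (u n)) (0 + y)"
        using y by (rule Y.hlim_add)
      then show ?thesis
        by simp
    qed
    then show ?thesis
      by blast
  qed
  then obtain T where T: "\<And>x u. x \<in> hcarrier X \<Longrightarrow> appr x u \<Longrightarrow> hlim Y (\<lambda>n. Q (u n)) (T x)"
    by metis
  have obtain_appr: "\<exists>u. appr x u" if "x \<in> hcarrier X" for x
    using dense[OF that] appr_def by blast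
  have "linear_op X Y T"
    unfolding linear_op_def
  proof (intro conjI ballI allI)
    fix x assume x: "x \<in> hcarrier X"
    obtain u where u: "appr x u"
      using obtain_appr[OF x] by blast
    then have mem: "u n \<in> hcarrier D" for n
      by (simp add: appr_def)
    show "T x \<in> hcarrier Y"
      using T[OF x u] by (simp add: hlim_def)
    show "T (hscale X c x) = hscale Y c (T x)" for c
    proof (rule Y.hlim_unique)
      have "appr (hscale X c x) (\<lambda>n. hscale D c (u n))"
        using u X.hlim_scale[of "\<lambda>n. P (u n)" x c] by (simp add: appr_def P')
      then show "hlim Y (\<lambda>n. Q (hscale D c (u n))) (T (hscale X c x))"
        using x by (intro T) auto
      show "hlim Y (\<lambda>n. Q (hscale D c (u n))) (hscale Y c (T x))"
        using Y.hlim_scale[OF T[OF x u], of c] mem by (simp add: Q')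
    qed
    fix y assume y: "y \<in> hcarrier X"
    obtain v where v: "appr y v"
      using obtain_appr[OF y] by blast
    then have mem': "v n \<in> hcarrier D" for n
      by (simp add: appr_def)
    show "T (x + y) = T x + T y"
    proof (rule Y.hlim_unique)
      have "appr (x + y) (\<lambda>n. u n + v n)"
        using u v X.hlim_add[of "\<lambda>n. P (u n)" x "\<lambda>n. P (v n)" y] by (simp add: appr_def P')
      then show "hlim Y (\<lambda>n. Q (u n + v n)) (T (x + y))"
        using x y by (intro T) auto
      show "hlim Y (\<lambda>n. Q (u n + v n)) (T x + T y)"
        using Y.hlim_add[OF T[OF x u] T[OF y v]] mem mem' by (simp add: Q')
    qed
  qed
  moreover have "hinner Y (T x) (T x) = hinner X x x" if x: "x \<in> hcarrier X" for x
  proof -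
    obtain u where u: "appr x u"
      using obtain_appr[OF x] by blast
    then have lim: "hlim X (\<lambda>n. P (u n)) x" and mem: "u n \<in> hcarrier D" for n
      by (simp_all add: appr_def)
    have "hinner Y (Q (u n)) (Q (u n)) = hinner X (P (u n)) (P (u n))" for n
      using mem isometryD(3)[OF P] isometryD(3)[OF Q] by (simp add: X.hinner_self Y.hinner_self P' Q')
    then show ?thesis
      using X.hinner_tendsto[OF lim lim] Y.hinner_tendsto[OF T[OF x u] T[OF x u]] LIMSEQ_unique
      by simp
  qed
  ultimately have "isometry X Y T"
    by (rule isometryI)
  moreover have "T (P u) = Q u" if u: "u \<in> hcarrier D" for u
  proof (rule Y.hlim_unique)
    show "hlim Y (\<lambda>n. Q u) (T (P u))"
      using u by (intro T) (auto simp: appr_def P' X.hlim_const)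
    show "hlim Y (\<lambda>n. Q u) (Q u)"
      using u by (simp add: Y.hlim_const Q')
  qed
  ultimately show ?thesis
    by blast
qed

section \<open>Kolmogorov decomposition of operator kernels\<close>

text \<open>The algebraic direct sum of copies of \<open>H\<close> indexed by \<open>I\<close>,
  coded by total functions so that the operations are pointwise.\<close>

definition fin_supp :: "'i set \<Rightarrow> 'h::ab_group_add hspace \<Rightarrow> ('i \<Rightarrow> 'h) set"
  where "fin_supp I H =
    {u. (\<forall>i. u i \<in> hcarrier H) \<and> finite {i. u i \<noteq> 0} \<and> {i. u i \<noteq> 0} \<subseteq> I}"

text \<open>The linear extension of a family of maps to the direct sum. \<open>I\<close> may be
  infinite, so the sum runs over the support; as supports vary with u, computations pass to a common
  finite superset.\<close>

definition supp_sum :: "('i \<Rightarrow> 'h::zero \<Rightarrow> 'c::comm_monoid_add) \<Rightarrow> ('i \<Rightarrow> 'h) \<Rightarrow> 'c"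
  where "supp_sum F u = (\<Sum>i | u i \<noteq> 0. F i (u i))"

definition single :: "'i \<Rightarrow> 'h::zero \<Rightarrow> 'i \<Rightarrow> 'h"
  where "single i h = (\<lambda>j. if j = i then h else 0)"

definition fin_space ::
    "'i set \<Rightarrow> 'h::ab_group_add hspace \<Rightarrow> (('i \<Rightarrow> 'h) \<Rightarrow> ('i \<Rightarrow> 'h) \<Rightarrow> complex) \<Rightarrow> ('i \<Rightarrow> 'h) hspace"
  where "fin_space I H B =
    \<lparr>hcarrier = fin_supp I H, hscale = (\<lambda>c u i. hscale H c (u i)), hinner = B\<rparr>"

lemma fin_space_simps [simp]:
  "hcarrier (fin_space I H B) = fin_supp I H"
  "hscale (fin_space I H B) = (\<lambda>c u i. hscale H c (u i))"
  "hinner (fin_space I H B) = B"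
  by (simp_all add: fin_space_def)

lemma sum_fun_apply: "(\<Sum>i\<in>A. f i) x = (\<Sum>i\<in>A. f i x)"
  by (induction A rule: infinite_finite_induct) auto

lemma supp_sum_superset:
  assumes "finite S" "{i. u i \<noteq> 0} \<subseteq> S" "\<And>i. i \<in> S \<Longrightarrow> F i 0 = 0"
  shows "supp_sum F u = (\<Sum>i\<in>S. F i (u i))"
  unfolding supp_sum_def by (rule sum.mono_neutral_left) (use assms in auto)

lemma supp_sum_single:
  assumes "F i 0 = 0"
  shows "supp_sum F (single i h) = F i h"
  by (subst supp_sum_superset[of "{i}"]) (auto simp: single_def assms split: if_splits)

context semi_inner_space
begin

lemma fin_suppD:
  assumes "u \<in> fin_supp I X"
  shows "u i \<in> hcarrier X" "finite {i. u i \<noteq> 0}" "u i \<noteq> 0 \<Longrightarrow> i \<in> I"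
  using assms by (auto simp: fin_supp_def)

lemma single_mem: "i \<in> I \<Longrightarrow> h \<in> hcarrier X \<Longrightarrow> single i h \<in> fin_supp I X"
  by (auto simp: fin_supp_def single_def)

lemma fin_supp_add:
  assumes "u \<in> fin_supp I X" "v \<in> fin_supp I X"
  shows "u + v \<in> fin_supp I X"
proof -
  have "{i. (u + v) i \<noteq> 0} \<subseteq> {i. u i \<noteq> 0} \<union> {i. v i \<noteq> 0}"
    by auto
  then show ?thesis
    using assms unfolding fin_supp_def by (auto intro: finite_subset)
qed

lemma fin_supp_scale:
  assumes "u \<in> fin_supp I X"
  shows "(\<lambda>i. hscale X c (u i)) \<in> fin_supp I X"
proof -
  have "{i. hscale X c (u i) \<noteq> 0} \<subseteq> {i. u i \<noteq> 0}"
    by auto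
  then show ?thesis
    using assms unfolding fin_supp_def by (auto intro: finite_subset)
qed

lemma supp_sum_add:
  fixes F :: "'i \<Rightarrow> 'a \<Rightarrow> 'c::ab_group_add"
  assumes F: "\<And>i x y. i \<in> I \<Longrightarrow> x \<in> hcarrier X \<Longrightarrow> y \<in> hcarrier X \<Longrightarrow> F i (x + y) = F i x + F i y"
    and u: "u \<in> fin_supp I X" and v: "v \<in> fin_supp I X"
  shows "supp_sum F (u + v) = supp_sum F u + supp_sum F v"
proof -
  define S where "S = {i. u i \<noteq> 0} \<union> {i. v i \<noteq> 0}"
  have S: "finite S" "S \<subseteq> I"
    using u v by (auto simp: S_def fin_supp_def)
  have F0: "F i 0 = 0" if "i \<in> S" for i
    using F[of i 0 0] S that by auto
  have "supp_sum F (u + v) = (\<Sum>i\<in>S. F i ((u + v) i))"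
    by (rule supp_sum_superset) (use S F0 in \<open>auto simp: S_def\<close>)
  also have "\<dots> = (\<Sum>i\<in>S. F i (u i)) + (\<Sum>i\<in>S. F i (v i))"
    unfolding sum.distrib[symmetric] using S u v by (intro sum.cong) (auto simp: F fin_suppD)
  also have "(\<Sum>i\<in>S. F i (u i)) = supp_sum F u"
    by (rule supp_sum_superset[symmetric]) (use S F0 in \<open>auto simp: S_def\<close>)
  also have "(\<Sum>i\<in>S. F i (v i)) = supp_sum F v"
    by (rule supp_sum_superset[symmetric]) (use S F0 in \<open>auto simp: S_def\<close>)
  finally show ?thesis .
qed

text \<open>With g an arbitrary additive map, the lemma covers linear sums of vectors as well as the
  conjugate-linear second argument of a form.\<close>

lemma supp_sum_scale:
  assumes F: "\<And>i x. i \<in> I \<Longrightarrow> x \<in> hcarrier X \<Longrightarrow> F i (hscale X c x) = g (F i x)"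
    and F0: "\<And>i. i \<in> I \<Longrightarrow> F i 0 = 0"
    and g: "additive g" and u: "u \<in> fin_supp I X"
  shows "supp_sum F (\<lambda>i. hscale X c (u i)) = g (supp_sum F u)"
proof -
  let ?S = "{i. u i \<noteq> 0}"
  have "supp_sum F (\<lambda>i. hscale X c (u i)) = (\<Sum>i\<in>?S. F i (hscale X c (u i)))"
    by (rule supp_sum_superset) (use u F0 in \<open>auto simp: fin_suppD\<close>)
  also have "\<dots> = (\<Sum>i\<in>?S. g (F i (u i)))"
    using u by (intro sum.cong) (auto simp: F fin_suppD)
  also have "\<dots> = g (supp_sum F u)"
    unfolding supp_sum_def by (rule additive.sum[OF g, symmetric])
  finally show ?thesis .
qed

lemma vector_space_fin_space: "vector_space (hscale (fin_space I X B))"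
  by unfold_locales (simp_all add: fun_eq_iff scale_right_distrib scale_left_distrib)

lemma semi_inner_space_fin_space:
  assumes "\<And>u v w. \<lbrakk>u \<in> fin_supp I X; v \<in> fin_supp I X; w \<in> fin_supp I X\<rbrakk> \<Longrightarrow>
      B (u + v) w = B u w + B v w"
    and "\<And>u v c. \<lbrakk>u \<in> fin_supp I X; v \<in> fin_supp I X\<rbrakk> \<Longrightarrow> B (\<lambda>i. hscale X c (u i)) v = c * B u v"
    and "\<And>u v. \<lbrakk>u \<in> fin_supp I X; v \<in> fin_supp I X\<rbrakk> \<Longrightarrow> B v u = cnj (B u v)"
    and "\<And>u. u \<in> fin_supp I X \<Longrightarrow> B u u \<in> \<real>\<^sub>\<ge>\<^sub>0"
  shows "semi_inner_space (fin_space I X B)"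
proof -
  interpret V: vector_space "hscale (fin_space I X B)"
    by (rule vector_space_fin_space)
  have sub: "V.subspace (hcarrier (fin_space I X B))"
    by (rule V.subspaceI) (auto simp: fin_supp_add fin_supp_scale, simp add: fin_supp_def)
  show ?thesis
    by (unfold_locales, fact sub) (unfold fin_space_simps, (fact assms)+)
qed

end

lemma linear_op_supp_sum:
  assumes "semi_inner_space H" "semi_inner_space X" and e: "\<And>i. i \<in> I \<Longrightarrow> linear_op H X (e i)"
  shows "linear_op (fin_space I H B) X (supp_sum e)"
proof -
  interpret H: semi_inner_space H by fact
  interpret X: semi_inner_space X by fact
  have e0: "e i 0 = 0" if "i \<in> I" for i
    using linear_op_zero[OF H.semi_inner_space_axioms e[OF that]] .
  show ?thesis
    unfolding linear_op_def fin_space_simps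
  proof (intro conjI ballI allI)
    fix u assume u: "u \<in> fin_supp I H"
    show "supp_sum e u \<in> hcarrier X"
      unfolding supp_sum_def using u by (intro X.mem_sum) (auto simp: H.fin_suppD linear_opD(1)[OF e])
    show "supp_sum e (u + v) = supp_sum e u + supp_sum e v" if "v \<in> fin_supp I H" for v
      by (rule H.supp_sum_add[OF _ u that]) (simp add: linear_opD(2)[OF e])
    show "supp_sum e (\<lambda>i. hscale H c (u i)) = hscale X c (supp_sum e u)" for c
      by (rule H.supp_sum_scale[OF _ _ _ u])
        (auto simp: linear_opD(3)[OF e] e0 additive_def X.scale_right_distrib)
  qed
qed

lemma hinner_supp_sum:
  assumes "semi_inner_space H" "semi_inner_space X" and e: "\<And>i. i \<in> I \<Longrightarrow> linear_op H X (e i)"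
    and u: "u \<in> fin_supp I H" and v: "v \<in> fin_supp I H"
  shows "hinner X (supp_sum e u) (supp_sum e v) =
    (\<Sum>i | v i \<noteq> 0. \<Sum>j | u j \<noteq> 0. hinner X (e j (u j)) (e i (v i)))"
proof -
  interpret H: semi_inner_space H by fact
  interpret X: semi_inner_space X by fact
  have mem: "e i (w i) \<in> hcarrier X" if "w \<in> fin_supp I H" "w i \<noteq> 0" for w i
    using linear_opD(1)[OF e] H.fin_suppD[OF that(1)] that(2) by blast
  show ?thesis
    unfolding supp_sum_def
    by (subst X.hinner_sum_right) (auto intro!: sum.cong X.hinner_sum_left X.mem_sum mem u v)
qed

text \<open>The ranges of the maps \<open>e i\<close> together span a dense subspace, so bounded
  operators on \<open>X\<close> are determined by their values on the vectors
  \<open>e i h\<close>.\<close>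

definition total_family ::
    "'i set \<Rightarrow> 'h::ab_group_add hspace \<Rightarrow> 'b::ab_group_add hspace \<Rightarrow> ('i \<Rightarrow> 'h \<Rightarrow> 'b) \<Rightarrow> bool"
  where "total_family I H X e \<longleftrightarrow> (\<forall>i\<in>I. linear_op H X (e i)) \<and>
    (\<forall>x\<in>hcarrier X. \<exists>u. (\<forall>n. u n \<in> fin_supp I H) \<and> hlim X (\<lambda>n. supp_sum e (u n)) x)"

text \<open>Induction over a dense span. There is no case for multiples: by linearity of
  \<open>e i\<close>, a multiple of \<open>e i h\<close> is again of this form.\<close>

lemma total_family_induct [consumes 4, case_names member zero add limit]:
  assumes "semi_inner_space H" "semi_inner_space X" "total_family I H X e" "x \<in> hcarrier X"
    and member: "\<And>i h. i \<in> I \<Longrightarrow> h \<in> hcarrier H \<Longrightarrow> P (e i h)"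
    and zero: "P 0"
    and add: "\<And>x y. \<lbrakk>x \<in> hcarrier X; y \<in> hcarrier X; P x; P y\<rbrakk> \<Longrightarrow> P (x + y)"
    and limit: "\<And>f x. hlim X f x \<Longrightarrow> (\<And>n. P (f n)) \<Longrightarrow> P x"
  shows "P x"
proof -
  interpret H: semi_inner_space H by fact
  interpret X: semi_inner_space X by fact
  have e: "e i h \<in> hcarrier X" if "i \<in> I" "h \<in> hcarrier H" for i h
    using assms(3) that by (simp add: total_family_def linear_op_def)
  have "P (supp_sum e u)" if u: "u \<in> fin_supp I H" for u
  proof -
    have "(\<Sum>i\<in>S. e i (u i)) \<in> hcarrier X \<and> P (\<Sum>i\<in>S. e i (u i))" if "finite S" "S \<subseteq> I" for S
      using that
    proof (induction S rule: finite_induct)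
      case (insert i S)
      then have "e i (u i) \<in> hcarrier X" "P (e i (u i))"
        using H.fin_suppD(1)[OF u] by (simp_all add: e member)
      with insert show ?case
        by (simp add: add)
    qed (simp add: zero)
    from this[of "{i. u i \<noteq> 0}"] show ?thesis
      using H.fin_suppD[OF u] unfolding supp_sum_def by blast
  qed
  moreover obtain u where "\<And>n. u n \<in> fin_supp I H" "hlim X (\<lambda>n. supp_sum e (u n)) x"
    using assms(3,4) unfolding total_family_def by blast
  ultimately show ?thesis
    using limit by blast
qed

text \<open>Equal Gram matrices give equal norms to corresponding finite sums of the
  \<open>e i h\<close> and of the \<open>f i h\<close>. So every linear relation among the former
  holds among the latter, and the correspondence is a well-defined isometry that extends by
  density.\<close>

lemma total_family_isometry:
  assumes "semi_inner_space H" "hilbert_space X" "hilbert_space Y"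
    and total: "total_family I H X e" and f: "\<And>i. i \<in> I \<Longrightarrow> linear_op H Y (f i)"
    and gram: "\<And>i j h k. \<lbrakk>i \<in> I; j \<in> I; h \<in> hcarrier H; k \<in> hcarrier H\<rbrakk> \<Longrightarrow>
      hinner Y (f i h) (f j k) = hinner X (e i h) (e j k)"
  shows "\<exists>T. isometry X Y T \<and> (\<forall>i\<in>I. \<forall>h\<in>hcarrier H. T (e i h) = f i h)"
proof -
  interpret H: semi_inner_space H by fact
  interpret X: hilbert_space X by fact
  interpret Y: hilbert_space Y by fact
  have e: "linear_op H X (e i)" if "i \<in> I" for i
    using total that by (simp add: total_family_def)
  \<comment> \<open>The inner product of \<open>X\<close> pulled back to the direct sum. It makes
    \<open>supp_sum e\<close> isometric by definition, and \<open>gram\<close> does the same for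
    \<open>supp_sum f\<close>.\<close>
  define B where "B u v = hinner X (supp_sum e u) (supp_sum e v)" for u v
  let ?D = "fin_space I H B"
  have e_lin: "linear_op ?D X (supp_sum e)"
    by (intro linear_op_supp_sum H.semi_inner_space_axioms X.semi_inner_space_axioms e)
  have f_lin: "linear_op ?D Y (supp_sum f)"
    by (intro linear_op_supp_sum H.semi_inner_space_axioms Y.semi_inner_space_axioms f)
  note e_lin' = linear_opD[OF e_lin, simplified]
  have "semi_inner_space ?D"
    by (rule H.semi_inner_space_fin_space)
      (simp_all add: B_def e_lin' X.hinner_add_left X.hinner_scale_left X.hinner_self_nonneg
        X.hinner_commute[symmetric])
  moreover have "isometry ?D X (supp_sum e)"
    by (rule isometryI[OF e_lin]) (simp add: B_def)
  moreover have "isometry ?D Y (supp_sum f)"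
  proof (rule isometryI[OF f_lin])
    fix u assume "u \<in> hcarrier ?D"
    then have u: "u \<in> fin_supp I H"
      by simp
    show "hinner Y (supp_sum f u) (supp_sum f u) = hinner ?D u u"
      using hinner_supp_sum[OF H.semi_inner_space_axioms X.semi_inner_space_axioms e u u]
        hinner_supp_sum[OF H.semi_inner_space_axioms Y.semi_inner_space_axioms f u u]
        H.fin_suppD[OF u] gram
      by (simp add: B_def)
  qed
  moreover have "\<exists>u. (\<forall>n. u n \<in> hcarrier ?D) \<and> hlim X (\<lambda>n. supp_sum e (u n)) x"
    if "x \<in> hcarrier X" for x
    using total that by (simp add: total_family_def)
  ultimately obtain T where T: "isometry X Y T" "\<And>u. u \<in> fin_supp I H \<Longrightarrow> T (supp_sum e u) = supp_sum f u"
    using isometry_extension[OF _ assms(2,3), of ?D "supp_sum e" "supp_sum f"] by auto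
  have "T (e i h) = f i h" if "i \<in> I" "h \<in> hcarrier H" for i h
    using T(2)[OF H.single_mem[OF that]] supp_sum_single[of e i h] supp_sum_single[of f i h]
      linear_op_zero[OF H.semi_inner_space_axioms e[OF that(1)]]
      linear_op_zero[OF H.semi_inner_space_axioms f[OF that(1)]]
    by simp
  with T(1) show ?thesis
    by blast
qed

text \<open>Polarization: \<open>a, b, c, d\<close> stand for \<open>B u u, B u v, B v u, B v v\<close> with \<open>B\<close> sesquilinear, and the
  first two assumptions say that \<open>B\<close> is real on the diagonal at \<open>u + v\<close> and at \<open>u + \<i> v\<close>.\<close>

lemma hermitian_of_real_diagonal:
  fixes a b d :: complex
  assumes "Im (a + b + c + d) = 0" "Im (a - \<i> * b + \<i> * c + d) = 0" "Im a = 0" "Im d = 0"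
  shows "c = cnj b"
  using assms by (simp add: complex_eq_iff)

text \<open>The vector \<open>e j h\<close> is the function mapping i to \<open>K i j h\<close>, and
  0 outside \<open>I\<close>, where nothing is known of \<open>K\<close>. Pairing \<open>p u\<close>
  with v defines a form on the direct sum for which \<open>single i k\<close> acts as evaluation at
  i followed by the inner product with k; this reproducing property supplies the bound and the
  separation that the completion requires.\<close>

theorem kolmogorov_decomposition:
  fixes H :: "'h::ab_group_add hspace" and K :: "'i \<Rightarrow> 'i \<Rightarrow> 'h \<Rightarrow> 'h"
  assumes "hilbert_space H"
    and K: "\<And>i j. i \<in> I \<Longrightarrow> j \<in> I \<Longrightarrow> bounded_op H (K i j)"
    and psd: "\<And>u. u \<in> fin_supp I H \<Longrightarrow>
      (\<Sum>i | u i \<noteq> 0. \<Sum>j | u j \<noteq> 0. hinner H (K i j (u j)) (u i)) \<in> \<real>\<^sub>\<ge>\<^sub>0"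
  shows "\<exists>(X :: ('i \<Rightarrow> 'h) hspace) e. hilbert_space X \<and> total_family I H X e \<and>
    (\<forall>i\<in>I. \<forall>j\<in>I. \<forall>h\<in>hcarrier H. \<forall>k\<in>hcarrier H. hinner X (e j h) (e i k) = hinner H (K i j h) k)"
proof -
  interpret H: hilbert_space H by fact
  have K_lin: "linear_op H H (K i j)" if "i \<in> I" "j \<in> I" for i j
    using K[OF that] by (simp add: bounded_op_def)
  note K' = linear_opD[OF K_lin]
  define e where "e j h = (\<lambda>i. if i \<in> I then K i j h else 0)" for j h
  define p where "p = supp_sum e"
  have e0: "e j 0 = 0" if "j \<in> I" for j
    using linear_op_zero[OF H.semi_inner_space_axioms K_lin] that by (auto simp: e_def fun_eq_iff)
  have p_eq: "p u i = (\<Sum>j | u j \<noteq> 0. e j (u j) i)" for u i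
    by (simp add: p_def supp_sum_def sum_fun_apply)
  have p_mem: "p u i \<in> hcarrier H" if "u \<in> fin_supp I H" for u i
    unfolding p_eq using that by (intro H.mem_sum) (simp add: e_def K' H.fin_suppD)
  have p_add: "p (u + v) = p u + p v" if "u \<in> fin_supp I H" "v \<in> fin_supp I H" for u v
    unfolding p_def
    by (rule H.supp_sum_add[OF _ that]) (auto simp: e_def fun_eq_iff K')
  have p_scale: "p (\<lambda>i. hscale H c (u i)) = (\<lambda>i. hscale H c (p u i))" if "u \<in> fin_supp I H" for c u
    unfolding p_def
    by (rule H.supp_sum_scale[OF _ _ _ that])
      (auto simp: e0, auto simp: e_def fun_eq_iff K' additive_def H.scale_right_distrib)
  define B where "B u v = supp_sum (\<lambda>i. hinner H (p u i)) v" for u v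
  have B_add_left: "B (u + v) w = B u w + B v w"
    if "u \<in> fin_supp I H" "v \<in> fin_supp I H" "w \<in> fin_supp I H" for u v w
    unfolding B_def supp_sum_def sum.distrib[symmetric]
    using that by (intro sum.cong) (simp_all add: p_add p_mem H.hinner_add_left H.fin_suppD)
  have B_scale_left: "B (\<lambda>i. hscale H c (u i)) v = c * B u v"
    if "u \<in> fin_supp I H" "v \<in> fin_supp I H" for c u v
    unfolding B_def supp_sum_def sum_distrib_left
    using that by (intro sum.cong) (simp_all add: p_scale p_mem H.hinner_scale_left H.fin_suppD)
  have B_add_right: "B w (u + v) = B w u + B w v"
    if "u \<in> fin_supp I H" "v \<in> fin_supp I H" "w \<in> fin_supp I H" for u v w
    unfolding B_def by (rule H.supp_sum_add[OF _ that(1,2)]) (simp add: H.hinner_add_right p_mem that)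
  have B_scale_right: "B v (\<lambda>i. hscale H c (u i)) = cnj c * B v u"
    if "u \<in> fin_supp I H" "v \<in> fin_supp I H" for c u v
    unfolding B_def
    by (rule H.supp_sum_scale[OF _ _ _ that(1)])
      (auto simp: H.hinner_scale_right p_mem that additive_def distrib_left)
  have B_nonneg: "B u u \<in> \<real>\<^sub>\<ge>\<^sub>0" if u: "u \<in> fin_supp I H" for u
  proof -
    have "B u u = (\<Sum>i | u i \<noteq> 0. \<Sum>j | u j \<noteq> 0. hinner H (K i j (u j)) (u i))"
      unfolding B_def supp_sum_def
    proof (rule sum.cong)
      fix i assume "i \<in> {i. u i \<noteq> 0}"
      then have "i \<in> I"
        using H.fin_suppD[OF u] by simp
      then show "hinner H (p u i) (u i) = (\<Sum>j | u j \<noteq> 0. hinner H (K i j (u j)) (u i))"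
        unfolding p_eq using H.fin_suppD[OF u]
        by (subst H.hinner_sum_left) (auto simp: e_def K')
    qed simp
    then show ?thesis
      using psd[OF u] by simp
  qed
  \<comment> \<open>\<open>K\<close> is not assumed Hermitian; the symmetry follows from the
    diagonal of the form being real.\<close>
  have B_commute: "B v u = cnj (B u v)" if u: "u \<in> fin_supp I H" and v: "v \<in> fin_supp I H" for u v
  proof (rule hermitian_of_real_diagonal)
    have diag: "Im (B w w) = 0" if "w \<in> fin_supp I H" for w
      using B_nonneg[OF that] by (simp add: complex_nonneg_Reals_iff)
    show "Im (B u u) = 0" "Im (B v v) = 0"
      using diag u v by auto
    show "Im (B u u + B u v + B v u + B v v) = 0"
      using diag[OF H.fin_supp_add[OF u v]] u v
      by (simp add: B_add_left B_add_right H.fin_supp_add algebra_simps)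
    let ?w = "\<lambda>i. hscale H \<i> (v i)"
    have w: "?w \<in> fin_supp I H"
      using v by (rule H.fin_supp_scale)
    have "B (u + ?w) (u + ?w) = B u u - \<i> * B u v + \<i> * B v u + B v v"
      using u v w
      by (simp add: B_add_left B_add_right H.fin_supp_add B_scale_left B_scale_right algebra_simps)
    then show "Im (B u u - \<i> * B u v + \<i> * B v u + B v v) = 0"
      using diag[OF H.fin_supp_add[OF u w]] by simp
  qed
  let ?D = "fin_space I H B"
  interpret D: semi_inner_space ?D
    by (rule H.semi_inner_space_fin_space) (fact B_add_left B_scale_left B_commute B_nonneg)+
  have B_single: "B u (single i k) = hinner H (p u i) k"
    if "u \<in> fin_supp I H" for u i k
    unfolding B_def using that by (intro supp_sum_single) (simp add: p_mem)
  have p_single: "p (single j h) = e j h" if "j \<in> I" for j h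
    unfolding p_def using e0[OF that] by (rule supp_sum_single)
  \<comment> \<open>Diagonal entries suffice, since the norm of \<open>single i h\<close> depends
    only on \<open>K i i\<close>. Outside \<open>I\<close> any nonnegative constant will do, because
    \<open>p u\<close> vanishes there.\<close>
  have "\<exists>c\<ge>0. i \<in> I \<longrightarrow> (\<forall>h\<in>hcarrier H. hnorm H (K i i h) \<le> c * hnorm H h)" for i
  proof (cases "i \<in> I")
    case True
    then obtain c where c: "\<forall>h\<in>hcarrier H. hnorm H (K i i h) \<le> c * hnorm H h"
      using K[of i i] by (auto simp: bounded_op_def)
    have "hnorm H (K i i h) \<le> \<bar>c\<bar> * hnorm H h" if "h \<in> hcarrier H" for h
      using that c H.hnorm_nonneg[OF that] mult_right_mono[of c "\<bar>c\<bar>" "hnorm H h"] by force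
    then show ?thesis
      by (intro exI[of _ "\<bar>c\<bar>"]) auto
  qed auto
  then obtain C where C: "C i \<ge> 0"
      "i \<in> I \<Longrightarrow> h \<in> hcarrier H \<Longrightarrow> hnorm H (K i i h) \<le> C i * hnorm H h" for i h
    by metis
  have norm_single: "hnorm ?D (single i h) \<le> sqrt (C i) * hnorm H h"
    if "i \<in> I" "h \<in> hcarrier H" for i h
  proof -
    have "hinner ?D (single i h) (single i h) = hinner H (K i i h) h"
      using that by (simp add: B_single H.single_mem p_single) (simp add: e_def)
    then have "(hnorm ?D (single i h))\<^sup>2 = Re (hinner H (K i i h) h)"
      using D.hinner_self[of "single i h"] H.single_mem[OF that] by (simp flip: of_real_power)
    also have "\<dots> \<le> hnorm H (K i i h) * hnorm H h"
      using that complex_Re_le_cmod H.cauchy_schwarz[of "K i i h" h] K'(1) order_trans by blast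
    also have "\<dots> \<le> C i * hnorm H h * hnorm H h"
      using that C by (intro mult_right_mono) auto
    also have "\<dots> = (sqrt (C i) * hnorm H h)\<^sup>2"
      using C(1) by (simp add: power_mult_distrib power2_eq_square)
    finally show ?thesis
      using that C(1) by (meson power2_le_imp_le mult_nonneg_nonneg real_sqrt_ge_zero H.hnorm_nonneg)
  qed
  interpret functional_completion ?D H p "\<lambda>i. sqrt (C i)"
  proof unfold_locales
    show "p u i \<in> hcarrier H" if "u \<in> hcarrier ?D" for u i
      using p_mem that by simp
    show "p (u + v) i = p u i + p v i" if "u \<in> hcarrier ?D" "v \<in> hcarrier ?D" for u v i
      using p_add that by simp
    show "p (hscale ?D c u) i = hscale H c (p u i)" if "u \<in> hcarrier ?D" for u c i
      using p_scale that by simp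
    \<comment> \<open>By the reproducing property the square of the left-hand side is the inner
      product of u with \<open>single i (p u i)\<close>. Cauchy-Schwarz and
      \<open>norm_single\<close> leave one factor \<open>hnorm H (p u i)\<close> to cancel.\<close>
    show "hnorm H (p u i) \<le> sqrt (C i) * hnorm ?D u" if "u \<in> hcarrier ?D" for u i
    proof -
      have u: "u \<in> fin_supp I H"
        using that by simp
      let ?h = "p u i"
      have h: "?h \<in> hcarrier H"
        using p_mem[OF u] .
      show ?thesis
      proof (cases "i \<in> I \<and> ?h \<noteq> 0")
        case False
        then have "?h = 0"
          by (cases "i \<in> I") (auto simp: p_eq e_def)
        moreover have "0 \<le> sqrt (C i) * hnorm ?D u"
          using C(1) D.hnorm_nonneg[OF that] by simp
        ultimately show ?thesis
          by simp
      next
        case True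
        then have pos: "hnorm H ?h > 0"
          using H.hnorm_nonneg[OF h] H.hnorm_eq_0D[OF h] by force
        have "(hnorm H ?h)\<^sup>2 = cmod (hinner ?D u (single i ?h))"
          using B_single[OF u, of i ?h] H.hinner_self[OF h] by (simp add: norm_power)
        also have "\<dots> \<le> hnorm ?D u * hnorm ?D (single i ?h)"
          using u h True H.single_mem by (intro D.cauchy_schwarz) auto
        also have "\<dots> \<le> hnorm ?D u * (sqrt (C i) * hnorm H ?h)"
          using True h u by (intro mult_left_mono norm_single) auto
        finally have "hnorm H ?h * hnorm H ?h \<le> (sqrt (C i) * hnorm ?D u) * hnorm H ?h"
          by (simp add: power2_eq_square algebra_simps)
        then show ?thesis
          using pos mult_le_cancel_right_pos by blast
      qed
    qed
    \<comment> \<open>The support of v is finite, so only finitely many values of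
      \<open>p (w n)\<close> enter.\<close>
    show "(\<lambda>n. hinner ?D (w n) v) \<longlonglongrightarrow> 0"
      if w: "\<And>n. w n \<in> hcarrier ?D" and v: "v \<in> hcarrier ?D"
        and null: "\<And>i. (\<lambda>n. hnorm H (p (w n) i)) \<longlonglongrightarrow> 0" for w v
    proof -
      have "(\<lambda>n. hinner H (p (w n) i) (v i)) \<longlonglongrightarrow> 0" for i
        using w v null H.fin_suppD(1)[of v I i]
        by (intro H.hinner_tendsto_zero(1) H.hlim_hCauchy[OF H.hlim_const]) (auto simp: p_mem)
      then have "(\<lambda>n. \<Sum>i | v i \<noteq> 0. hinner H (p (w n) i) (v i)) \<longlonglongrightarrow> (\<Sum>i | v i \<noteq> 0. 0)"
        by (intro tendsto_sum)
      then show ?thesis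
        by (simp add: B_def supp_sum_def)
    qed
  qed
  have "hinner completion (e j h) (e i k) = hinner H (K i j h) k"
    if "i \<in> I" "j \<in> I" "h \<in> hcarrier H" "k \<in> hcarrier H" for i j h k
  proof -
    have "hinner completion (p (single j h)) (p (single i k)) = B (single j h) (single i k)"
      using isometry_hinner[OF D.semi_inner_space_axioms X.semi_inner_space_axioms p_isometry]
        H.single_mem[OF that(1,4)] H.single_mem[OF that(2,3)] by simp
    then show ?thesis
      using that by (simp add: p_single B_single H.single_mem) (simp add: e_def)
  qed
  moreover have "total_family I H completion e"
    unfolding total_family_def
  proof (intro conjI ballI)
    fix j assume j: "j \<in> I"
    have "e j h \<in> hcarrier completion" if "h \<in> hcarrier H" for h
      using isometryD(2)[OF p_isometry, of "single j h"] p_single[OF j] H.single_mem[OF j that] by simp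
    then show "linear_op H completion (e j)"
      unfolding linear_op_def using j
      by (simp del: completion_simps(1)) (auto simp: e_def fun_eq_iff K')
  next
    fix f assume "f \<in> hcarrier completion"
    then show "\<exists>u. (\<forall>n. u n \<in> fin_supp I H) \<and> hlim completion (\<lambda>n. supp_sum e (u n)) f"
      using completion_dense unfolding p_def[symmetric] fin_space_simps by blast
  qed
  ultimately show ?thesis
    using hilbert_space_completion by blast
qed

section \<open>Commuting row isometries and multi-Toeplitz kernels\<close>

lemma isometry_comp: "isometry X Y T \<Longrightarrow> isometry Y Z S \<Longrightarrow> isometry X Z (S \<circ> T)"
  by (simp add: isometry_def linear_op_def)

lemma isometry_foldr:
  assumes "\<And>a. a \<in> set w \<Longrightarrow> isometry X X (A a)"
  shows "isometry X X (foldr A w)"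
  using assms
proof (induction w)
  case Nil
  then show ?case by (simp add: isometry_def linear_op_def)
next
  case (Cons a w)
  then have "isometry X X (A a \<circ> foldr A w)"
    by (intro isometry_comp) auto
  then show ?case by (simp only: foldr.simps)
qed

lemma isometries_eqI:
  assumes "semi_inner_space H" "semi_inner_space X" "hilbert_space Y" and total: "total_family I H X e"
    and S: "isometry X Y S" and T: "isometry X Y T"
    and eq: "\<And>i h. i \<in> I \<Longrightarrow> h \<in> hcarrier H \<Longrightarrow> S (e i h) = T (e i h)"
    and x: "x \<in> hcarrier X"
  shows "S x = T x"
  using assms(1,2) total x
proof (induction rule: total_family_induct)
  case zero
  then show ?case
    using linear_op_zero[OF assms(2)] isometryD(1)[OF S] isometryD(1)[OF T] by metis
next
  case (add x y)
  then show ?case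
    by (simp add: linear_opD(2)[OF isometryD(1)[OF S]] linear_opD(2)[OF isometryD(1)[OF T]])
next
  case (limit f x)
  then show ?case
    using isometry_hlim[OF assms(2) S limit(1)] isometry_hlim[OF assms(2) T limit(1)]
      hilbert_space.hlim_unique[OF assms(3)] by simp
qed (rule eq)

text \<open>Orthogonality is additive and continuous in each argument, so the vectors of the total
  family are replaced by arbitrary ones in the second argument and then in the first.\<close>

lemma isometries_orthogonalI:
  assumes "semi_inner_space H" "semi_inner_space X" "semi_inner_space Y"
    and total: "total_family I H X e"
    and S: "isometry X Y S" and T: "isometry X Y T"
    and orth: "\<And>i j h k. \<lbrakk>i \<in> I; j \<in> I; h \<in> hcarrier H; k \<in> hcarrier H\<rbrakk> \<Longrightarrow>
      hinner Y (S (e i h)) (T (e j k)) = 0"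
    and x: "x \<in> hcarrier X" and y: "y \<in> hcarrier X"
  shows "hinner Y (S x) (T y) = 0"
proof -
  interpret X: semi_inner_space X by fact
  interpret Y: semi_inner_space Y by fact
  note S' = linear_opD[OF isometryD(1)[OF S]] and T' = linear_opD[OF isometryD(1)[OF T]]
  note T0 = linear_op_zero[OF assms(2) isometryD(1)[OF S]] linear_op_zero[OF assms(2) isometryD(1)[OF T]]
  have mem: "e i h \<in> hcarrier X" if "i \<in> I" "h \<in> hcarrier H" for i h
    using total that by (simp add: total_family_def linear_op_def)
  have single: "hinner Y (S (e i h)) (T y) = 0" if "i \<in> I" "h \<in> hcarrier H" for i h
    using assms(1,2) total y
  proof (induction rule: total_family_induct)
    case (member j k)
    then show ?case using orth that by simp
  next
    case zero
    then show ?case using mem that by (simp add: T0 S')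
  next
    case (add u v)
    then show ?case using mem that by (simp add: S' T' Y.hinner_add_right)
  next
    case (limit f u)
    have "(\<lambda>n. hinner Y (S (e i h)) (T (f n))) \<longlonglongrightarrow> hinner Y (S (e i h)) (T u)"
      using mem that
      by (intro Y.hinner_tendsto Y.hlim_const isometry_hlim[OF assms(2) T limit(1)] S')
    then show ?case
      using limit(2) by (simp add: LIMSEQ_const_iff)
  qed
  show ?thesis
    using assms(1,2) total x
  proof (induction rule: total_family_induct)
    case (member j k)
    then show ?case by (rule single)
  next
    case zero
    then show ?case using y by (simp add: T0 T')
  next
    case (add u v)
    then show ?case using y by (simp add: S' T' Y.hinner_add_left)
  next
    case (limit f u)
    have "(\<lambda>n. hinner Y (S (f n)) (T y)) \<longlonglongrightarrow> hinner Y (S u) (T y)"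
      using y by (intro Y.hinner_tendsto Y.hlim_const isometry_hlim[OF assms(2) S limit(1)] T')
    then show ?case
      using limit(2) by (simp add: LIMSEQ_const_iff)
  qed
qed

text \<open>This also shows that the descriptions by \<open>THE\<close> in the adjoint and the projection denote.\<close>

lemma eq_orth_proj_adj_iff:
  assumes "hilbert_space H" "hilbert_space X" and J: "isometry H X J" and A: "isometry X X A"
    and x: "x \<in> hcarrier X" and h: "h \<in> hcarrier H"
  shows "J h = orth_proj X (J ` hcarrier H) (adj X A x) \<longleftrightarrow>
    (\<forall>k\<in>hcarrier H. hinner H h k = hinner X x (A (J k)))"
proof -
  interpret H: hilbert_space H by fact
  interpret X: hilbert_space X by fact
  note J' = linear_opD[OF isometryD(1)[OF J]] and A' = linear_opD[OF isometryD(1)[OF A]]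
  note J_inner = isometry_hinner[OF H.semi_inner_space_axioms X.semi_inner_space_axioms J]
  note A_inner = isometry_hinner[OF X.semi_inner_space_axioms X.semi_inner_space_axioms A]
  \<comment> \<open>As \<open>A\<close> is isometric and \<open>x - A z\<close> is orthogonal to its
    range, z satisfies the defining property of the adjoint at x.\<close>
  obtain z where z: "z \<in> hcarrier X" and "\<forall>y\<in>hcarrier X. hinner X (x - A z) (A y) = 0"
    using isometry_projection[OF assms(2) X.semi_inner_space_axioms A x] by blast
  then have xA: "hinner X x (A y) = hinner X z y" if "y \<in> hcarrier X" for y
    using that x by (simp add: X.hinner_diff_left A' A_inner)
  have adj: "adj X A x = z"
    unfolding adj_def
  proof (rule the_equality)
    show "z \<in> hcarrier X \<and> (\<forall>y\<in>hcarrier X. hinner X (A y) x = hinner X y z)"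
    proof (intro conjI ballI z)
      fix y assume y: "y \<in> hcarrier X"
      show "hinner X (A y) x = hinner X y z"
        using X.hinner_commute[OF x A'(1)[OF y]] X.hinner_commute[OF z y] xA[OF y] by simp
    qed
    then show "w = z" if "w \<in> hcarrier X \<and> (\<forall>y\<in>hcarrier X. hinner X (A y) x = hinner X y w)" for w
      using that by (intro X.hinner_eqI) auto
  qed
  obtain m where m: "m \<in> hcarrier H" and m_orth: "\<forall>k\<in>hcarrier H. hinner X (z - J m) (J k) = 0"
    using isometry_projection[OF assms(1) X.semi_inner_space_axioms J z] by blast
  have proj: "orth_proj X (J ` hcarrier H) z = J m"
    unfolding orth_proj_def
  proof (rule the_equality)
    show "J m \<in> J ` hcarrier H \<and> (\<forall>y\<in>J ` hcarrier H. hinner X (z - J m) y = 0)"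
      using m m_orth by blast
    fix w assume w: "w \<in> J ` hcarrier H \<and> (\<forall>y\<in>J ` hcarrier H. hinner X (z - w) y = 0)"
    then obtain l where l: "l \<in> hcarrier H" "w = J l"
      by blast
    have "hinner X (J l - J m) (J (l - m)) = hinner X (z - J m) (J (l - m)) - hinner X (z - J l) (J (l - m))"
      using z l m by (simp add: X.hinner_diff_left J')
    also have "\<dots> = 0"
      using w l m m_orth by simp
    finally have "hinner X (J l - J m) (J l - J m) = 0"
      using l m linear_op_diff[OF H.semi_inner_space_axioms isometryD(1)[OF J]] by simp
    then show "w = J m"
      using l m X.hinner_self_eq_0[of "J l - J m"] J' by simp
  qed
  have zJ: "hinner X x (A (J k)) = hinner H m k" if k: "k \<in> hcarrier H" for k
    using m_orth k z m by (simp add: xA J' X.hinner_diff_left J_inner)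
  \<comment> \<open>\<open>J m\<close> is the projected vector. Injectivity of \<open>J\<close>
    moves the equation into \<open>H\<close>, where it can be tested against all k.\<close>
  have "J h = J m \<longleftrightarrow> h = m"
  proof
    assume "J h = J m"
    then have "hnorm X (J (h - m)) = 0"
      using h m linear_op_diff[OF H.semi_inner_space_axioms isometryD(1)[OF J]] by simp
    then show "h = m"
      using h m isometryD(3)[OF J, of "h - m"] H.hnorm_eq_0D[of "h - m"] by simp
  qed simp
  also have "\<dots> \<longleftrightarrow> (\<forall>k\<in>hcarrier H. hinner H h k = hinner H m k)"
  proof
    assume "\<forall>k\<in>hcarrier H. hinner H h k = hinner H m k"
    with h m show "h = m"
      by (intro H.hinner_left_eqI) auto
  qed simp
  finally show ?thesis
    using zJ by (simp add: adj proj)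
qed

section \<open>Multiwords, comparability and the shift property of Toeplitz kernels\<close>

lemma multiwordsD:
  assumes "\<sigma> \<in> multiwords ns"
  shows "length \<sigma> = length ns" "i < length ns \<Longrightarrow> set (\<sigma> ! i) \<subseteq> {1..ns ! i}"
  using assms by (auto simp: multiwords_def)

lemma multiwordsI:
  assumes "length \<sigma> = length ns" "\<And>i. i < length ns \<Longrightarrow> set (\<sigma> ! i) \<subseteq> {1..ns ! i}"
  shows "\<sigma> \<in> multiwords ns"
  using assms by (auto simp: multiwords_def)

lemma neutral_mem: "neutral ns \<in> multiwords ns"
  by (rule multiwordsI) (auto simp: neutral_def)

lemma prepend_mem:
  assumes "\<sigma> \<in> multiwords ns" "i < length ns" "set w \<subseteq> {1..ns ! i}"
  shows "\<sigma>[i := w @ \<sigma> ! i] \<in> multiwords ns"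
  using assms multiwordsD[OF assms(1)] by (intro multiwordsI) (auto simp: nth_list_update)

lemma left_comparable_iff:
  "left_comparable \<sigma> \<omega> \<longleftrightarrow> length \<sigma> = length \<omega> \<and>
    (\<forall>i<length \<sigma>. prefix (\<sigma> ! i) (\<omega> ! i) \<or> prefix (\<omega> ! i) (\<sigma> ! i))"
  by (auto simp: left_comparable_def list_all2_conv_all_nth strict_prefix_def)

text \<open>The common prefix u is the shorter of the two words, so at most one of the remainders is
  nonempty.\<close>

lemma comparable_split:
  assumes "prefix v w \<or> prefix w v"
  obtains u where "v = u @ c_plus v w" "w = u @ c_minus v w"
proof (cases "prefix v w")
  case True
  then show ?thesis
    by (intro that[of v]) (auto simp: c_plus_def c_minus_def strict_prefix_def prefix_def)
next
  case False
  with assms show ?thesis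
    by (intro that[of w]) (auto simp: c_plus_def c_minus_def strict_prefix_def prefix_def)
qed

lemma set_c_plus: "set (c_plus v w) \<subseteq> set v"
  by (auto simp: c_plus_def dest: in_set_dropD)

lemma set_c_minus: "set (c_minus v w) \<subseteq> set w"
  by (auto simp: c_minus_def dest: in_set_dropD)

lemma map2_c_mem:
  assumes "\<sigma> \<in> multiwords ns" "\<omega> \<in> multiwords ns"
  shows "map2 c_plus \<sigma> \<omega> \<in> multiwords ns" "map2 c_minus \<sigma> \<omega> \<in> multiwords ns"
proof -
  note len = multiwordsD(1)[OF assms(1)] multiwordsD(1)[OF assms(2)]
  show "map2 c_plus \<sigma> \<omega> \<in> multiwords ns"
    using len multiwordsD(2)[OF assms(1)]
    by (intro multiwordsI) (simp_all add: order_trans[OF set_c_plus])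
  show "map2 c_minus \<sigma> \<omega> \<in> multiwords ns"
    using len multiwordsD(2)[OF assms(2)]
    by (intro multiwordsI) (simp_all add: order_trans[OF set_c_minus])
qed

lemma left_comparable_prepend:
  assumes "length \<sigma> = length \<omega>" "i < length \<sigma>"
  shows "left_comparable (\<sigma>[i := a # \<sigma> ! i]) (\<omega>[i := b # \<omega> ! i]) \<longleftrightarrow>
    a = b \<and> left_comparable \<sigma> \<omega>"
  using assms by (auto simp: left_comparable_iff nth_list_update)

lemma map2_c_prepend:
  assumes "length \<sigma> = length \<omega>" "i < length \<sigma>"
  shows "map2 c_plus (\<sigma>[i := a # \<sigma> ! i]) (\<omega>[i := a # \<omega> ! i]) = map2 c_plus \<sigma> \<omega>"
    "map2 c_minus (\<sigma>[i := a # \<sigma> ! i]) (\<omega>[i := a # \<omega> ! i]) = map2 c_minus \<sigma> \<omega>"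
  using assms by (auto intro!: nth_equalityI simp: nth_list_update c_plus_def c_minus_def)

lemma multi_toeplitzD:
  assumes "multi_toeplitz ns H K"
  shows "h \<in> hcarrier H \<Longrightarrow> K (neutral ns) (neutral ns) h = h"
    and "\<lbrakk>\<sigma> \<in> multiwords ns; \<omega> \<in> multiwords ns; h \<in> hcarrier H; left_comparable \<sigma> \<omega>\<rbrakk> \<Longrightarrow>
      K \<sigma> \<omega> h = K (map2 c_plus \<sigma> \<omega>) (map2 c_minus \<sigma> \<omega>) h"
    and "\<lbrakk>\<sigma> \<in> multiwords ns; \<omega> \<in> multiwords ns; h \<in> hcarrier H; \<not> left_comparable \<sigma> \<omega>\<rbrakk> \<Longrightarrow>
      K \<sigma> \<omega> h = 0"
  using assms unfolding multi_toeplitz_def by (blast, metis+)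

text \<open>A letter put in front of both i-th components joins their common prefix and changes
  neither comparability nor the remainders; distinct letters make these components incomparable. The
  two cases yield isometry and orthogonality of the operators built later.\<close>

lemma multi_toeplitz_shift:
  assumes "multi_toeplitz ns H K" "\<sigma> \<in> multiwords ns" "\<omega> \<in> multiwords ns" "h \<in> hcarrier H"
    and i: "i < length ns" "a \<in> {1..ns ! i}" "b \<in> {1..ns ! i}"
  shows "K (\<sigma>[i := a # \<sigma> ! i]) (\<omega>[i := b # \<omega> ! i]) h = (if a = b then K \<sigma> \<omega> h else 0)"
proof -
  have len: "length \<sigma> = length \<omega>" "i < length \<sigma>"
    using assms multiwordsD(1) by metis+
  have mem: "\<sigma>[i := a # \<sigma> ! i] \<in> multiwords ns" "\<omega>[i := b # \<omega> ! i] \<in> multiwords ns"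
    using prepend_mem[OF assms(2) i(1), of "[a]"] prepend_mem[OF assms(3) i(1), of "[b]"] i by simp_all
  show ?thesis
    using multi_toeplitzD(2,3)[OF assms(1) mem assms(4)] multi_toeplitzD(2,3)[OF assms(1-4)]
      left_comparable_prepend[OF len] map2_c_prepend[OF len]
    by (cases "a = b"; cases "left_comparable \<sigma> \<omega>") simp_all
qed

section \<open>Products of commuting row isometries along multiwords\<close>

locale commuting_isometries = hilbert_space X for X :: "'a::ab_group_add hspace" +
  fixes ns :: "nat list" and V :: "nat \<Rightarrow> nat \<Rightarrow> 'a \<Rightarrow> 'a"
  assumes commuting: "commuting_row_isometries X ns V"
begin

lemma letter_isometry: "i < length ns \<Longrightarrow> j \<in> {1..ns ! i} \<Longrightarrow> isometry X X (V i j)"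
  using commuting by (auto simp: commuting_row_isometries_def row_isometry_def)

lemma letter_orthogonal:
  "\<lbrakk>i < length ns; s \<in> {1..ns ! i}; t \<in> {1..ns ! i}; s \<noteq> t; x \<in> hcarrier X; y \<in> hcarrier X\<rbrakk>
    \<Longrightarrow> hinner X (V i s x) (V i t y) = 0"
  using commuting by (auto simp: commuting_row_isometries_def row_isometry_def)

lemma letter_commute:
  "\<lbrakk>i < length ns; s < length ns; i \<noteq> s; j \<in> {1..ns ! i}; t \<in> {1..ns ! s}; x \<in> hcarrier X\<rbrakk>
    \<Longrightarrow> V i j (V s t x) = V s t (V i j x)"
  using commuting unfolding commuting_row_isometries_def by blast

lemma word_isometry: "i < length ns \<Longrightarrow> set w \<subseteq> {1..ns ! i} \<Longrightarrow> isometry X X (foldr (V i) w)"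
  using letter_isometry by (intro isometry_foldr) blast

lemma word_letter_commute:
  assumes "i < length ns" "s < length ns" "i \<noteq> s" "set w \<subseteq> {1..ns ! i}" "t \<in> {1..ns ! s}"
    "x \<in> hcarrier X"
  shows "foldr (V i) w (V s t x) = V s t (foldr (V i) w x)"
  using assms(4)
proof (induction w)
  case (Cons a w)
  then have "foldr (V i) w x \<in> hcarrier X"
    using isometryD(2)[OF word_isometry[OF assms(1)]] assms(6) by simp
  then show ?case
    using Cons assms by (simp add: letter_commute)
qed simp

lemma word_commute:
  assumes "i < length ns" "s < length ns" "i \<noteq> s" "set w \<subseteq> {1..ns ! i}" "set v \<subseteq> {1..ns ! s}"
    "x \<in> hcarrier X"
  shows "foldr (V i) w (foldr (V s) v x) = foldr (V s) v (foldr (V i) w x)"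
  using assms(5)
proof (induction v)
  case (Cons b v)
  then have "foldr (V s) v x \<in> hcarrier X"
    using isometryD(2)[OF word_isometry[OF assms(2)]] assms(6) by simp
  then show ?case
    using Cons assms by (simp add: word_letter_commute)
qed simp

text \<open>The words branch into different letters after a common prefix. The operator of the
  prefix is isometric and cancels, and different letters of one row have orthogonal ranges.\<close>

lemma word_orthogonal:
  assumes i: "i < length ns" and v: "set v \<subseteq> {1..ns ! i}" and w: "set w \<subseteq> {1..ns ! i}"
    and "\<not> prefix v w" "\<not> prefix w v" and x: "x \<in> hcarrier X" and y: "y \<in> hcarrier X"
  shows "hinner X (foldr (V i) v x) (foldr (V i) w y) = 0"
proof -
  obtain u a v' b w' where dec: "a \<noteq> b" "v = u @ a # v'" "w = u @ b # w'"
    using assms parallel_decomp[of v w] by blast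
  have "hinner X (foldr (V i) v x) (foldr (V i) w y) =
      hinner X (V i a (foldr (V i) v' x)) (V i b (foldr (V i) w' y))"
    using isometry_hinner[OF semi_inner_space_axioms semi_inner_space_axioms word_isometry[OF i, of u]]
      dec v w x y isometryD(2)[OF letter_isometry[OF i]] isometryD(2)[OF word_isometry[OF i]]
    by simp
  also have "\<dots> = 0"
    using dec v w x y i isometryD(2)[OF word_isometry[OF i]] by (intro letter_orthogonal) auto
  finally show ?thesis .
qed

text \<open>The list of positions is a parameter to allow induction over it;
  \<open>multiword_op\<close> is the case of all positions in order.\<close>

abbreviation factors :: "nat list \<Rightarrow> nat list list \<Rightarrow> 'a \<Rightarrow> 'a"
  where "factors L \<sigma> \<equiv> foldr (\<lambda>i. foldr (V i) (\<sigma> ! i)) L"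

lemma factors_isometry:
  assumes "\<sigma> \<in> multiwords ns" "set L \<subseteq> {..<length ns}"
  shows "isometry X X (factors L \<sigma>)"
  using assms multiwordsD(2)[OF assms(1)] by (intro isometry_foldr word_isometry) auto

lemma multiword_op_factors: "\<sigma> \<in> multiwords ns \<Longrightarrow> multiword_op V \<sigma> = factors [0..<length ns] \<sigma>"
  by (simp add: multiword_op_def multiwordsD(1))

lemma multiword_op_isometry: "\<sigma> \<in> multiwords ns \<Longrightarrow> isometry X X (multiword_op V \<sigma>)"
  by (auto simp: multiword_op_factors intro: factors_isometry)

lemma factors_commute:
  assumes \<sigma>: "\<sigma> \<in> multiwords ns" and L: "set L \<subseteq> {..<length ns}" "i \<notin> set L"
    and i: "i < length ns" "set w \<subseteq> {1..ns ! i}" and x: "x \<in> hcarrier X"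
  shows "factors L \<sigma> (foldr (V i) w x) = foldr (V i) w (factors L \<sigma> x)"
  using L
proof (induction L)
  case (Cons s L)
  then have "factors L \<sigma> x \<in> hcarrier X"
    using isometryD(2)[OF factors_isometry[OF \<sigma>, of L]] x by simp
  then show ?case
    using Cons i multiwordsD(2)[OF \<sigma>] by (simp add: word_commute)
qed simp

text \<open>The i-th factor commutes with all those in front of it. This exposes an incomparable
  component as the leftmost factor of a product.\<close>

lemma factors_extract:
  assumes \<sigma>: "\<sigma> \<in> multiwords ns" and L: "set L \<subseteq> {..<length ns}" "distinct L" "i \<in> set L"
    and x: "x \<in> hcarrier X"
  shows "factors L \<sigma> x = foldr (V i) (\<sigma> ! i) (factors (remove1 i L) \<sigma> x)"
  using L
proof (induction L)
  case (Cons s L)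
  have mem: "factors (remove1 i L) \<sigma> x \<in> hcarrier X"
    using isometryD(2)[OF factors_isometry[OF \<sigma>, of "remove1 i L"]] x Cons.prems set_remove1_subset[of i L]
    by auto
  show ?case
    using Cons multiwordsD(2)[OF \<sigma>] mem by (auto simp: word_commute)
qed simp

text \<open>In the induction step the word \<open>\<beta> ! s\<close> has to pass the product of
  \<alpha> over the remaining positions. Distinctness of \<open>L\<close> keeps s out of these:
  letters of the same row need not commute.\<close>

lemma factors_append:
  assumes \<sigma>: "\<sigma> \<in> multiwords ns" and \<alpha>: "\<alpha> \<in> multiwords ns" and \<beta>: "\<beta> \<in> multiwords ns"
    and L: "set L \<subseteq> {..<length ns}" "distinct L" "\<And>i. i \<in> set L \<Longrightarrow> \<sigma> ! i = \<alpha> ! i @ \<beta> ! i"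
    and x: "x \<in> hcarrier X"
  shows "factors L \<sigma> x = factors L \<alpha> (factors L \<beta> x)"
  using L
proof (induction L)
  case (Cons s L)
  then have "factors L \<beta> x \<in> hcarrier X"
    using isometryD(2)[OF factors_isometry[OF \<beta>, of L]] x by simp
  then show ?case
    using Cons factors_commute[OF \<alpha>, of L s "\<beta> ! s"] multiwordsD(2)[OF \<beta>] by simp
qed simp

lemma multiword_op_gram:
  assumes \<sigma>: "\<sigma> \<in> multiwords ns" and \<omega>: "\<omega> \<in> multiwords ns"
    and x: "x \<in> hcarrier X" and y: "y \<in> hcarrier X"
  shows "hinner X (multiword_op V \<omega> x) (multiword_op V \<sigma> y) =
    (if left_comparable \<sigma> \<omega>
     then hinner X (multiword_op V (map2 c_minus \<sigma> \<omega>) x) (multiword_op V (map2 c_plus \<sigma> \<omega>) y) else 0)"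
proof (cases "left_comparable \<sigma> \<omega>")
  case True
  note len = multiwordsD(1)[OF \<sigma>] multiwordsD(1)[OF \<omega>]
  note c = map2_c_mem[OF \<sigma> \<omega>]
  have "\<exists>u. \<sigma> ! i = u @ c_plus (\<sigma> ! i) (\<omega> ! i) \<and> \<omega> ! i = u @ c_minus (\<sigma> ! i) (\<omega> ! i)"
    if "i < length ns" for i
    using True that len comparable_split unfolding left_comparable_iff by metis
  then obtain u where u: "\<And>i. i < length ns \<Longrightarrow> \<sigma> ! i = u i @ c_plus (\<sigma> ! i) (\<omega> ! i)"
      "\<And>i. i < length ns \<Longrightarrow> \<omega> ! i = u i @ c_minus (\<sigma> ! i) (\<omega> ! i)"
    by metis
  \<comment> \<open>The common prefixes of all components form a multiword of their own, so the
    operator to be cancelled is an isometry.\<close>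
  define \<alpha> where "\<alpha> = map u [0..<length ns]"
  have "set (u i) \<subseteq> {1..ns ! i}" if "i < length ns" for i
    using u(1)[OF that] multiwordsD(2)[OF \<sigma> that] by (metis le_sup_iff set_append)
  then have \<alpha>: "\<alpha> \<in> multiwords ns"
    by (intro multiwordsI) (simp_all add: \<alpha>_def)
  have "multiword_op V \<sigma> y = multiword_op V \<alpha> (multiword_op V (map2 c_plus \<sigma> \<omega>) y)"
    unfolding multiword_op_factors[OF \<sigma>] multiword_op_factors[OF \<alpha>] multiword_op_factors[OF c(1)]
    using u len by (intro factors_append \<sigma> \<alpha> c y) (auto simp: \<alpha>_def)
  moreover have "multiword_op V \<omega> x = multiword_op V \<alpha> (multiword_op V (map2 c_minus \<sigma> \<omega>) x)"
    unfolding multiword_op_factors[OF \<omega>] multiword_op_factors[OF \<alpha>] multiword_op_factors[OF c(2)]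
    using u len by (intro factors_append \<omega> \<alpha> c x) (auto simp: \<alpha>_def)
  ultimately show ?thesis
    using True isometry_hinner[OF semi_inner_space_axioms semi_inner_space_axioms multiword_op_isometry[OF \<alpha>]]
      isometryD(2)[OF multiword_op_isometry[OF c(1)] y] isometryD(2)[OF multiword_op_isometry[OF c(2)] x]
    by simp
next
  case False
  then obtain i where i: "i < length ns" "\<not> prefix (\<sigma> ! i) (\<omega> ! i)" "\<not> prefix (\<omega> ! i) (\<sigma> ! i)"
    using multiwordsD(1)[OF \<sigma>] multiwordsD(1)[OF \<omega>] by (auto simp: left_comparable_iff)
  let ?L = "remove1 i [0..<length ns]"
  have L: "set ?L \<subseteq> {..<length ns}"
    by auto
  have "multiword_op V \<omega> x = foldr (V i) (\<omega> ! i) (factors ?L \<omega> x)"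
    unfolding multiword_op_factors[OF \<omega>] using i by (intro factors_extract \<omega> x) auto
  moreover have "multiword_op V \<sigma> y = foldr (V i) (\<sigma> ! i) (factors ?L \<sigma> y)"
    unfolding multiword_op_factors[OF \<sigma>] using i by (intro factors_extract \<sigma> y) auto
  ultimately show ?thesis
    using False i multiwordsD(2)[OF \<sigma> i(1)] multiwordsD(2)[OF \<omega> i(1)]
      isometryD(2)[OF factors_isometry[OF \<omega> L] x] isometryD(2)[OF factors_isometry[OF \<sigma> L] y]
    by (simp add: word_orthogonal)
qed

end

text \<open>Pairing the dilation identity with \<open>J k\<close> removes the adjoint and the
  projection. Both directions of the theorem work with this form.\<close>

lemma naimark_dilation_iff_gram:
  assumes "hilbert_space H" "\<forall>\<sigma>\<in>multiwords ns. \<forall>\<omega>\<in>multiwords ns. bounded_op H (K \<sigma> \<omega>)"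
  shows "naimark_dilation ns H K X J V \<longleftrightarrow>
    hilbert_space X \<and> isometry H X J \<and> commuting_row_isometries X ns V \<and>
    (\<forall>\<sigma>\<in>multiwords ns. \<forall>\<omega>\<in>multiwords ns. \<forall>h\<in>hcarrier H. \<forall>k\<in>hcarrier H.
      hinner H (K \<sigma> \<omega> h) k = hinner X (multiword_op V \<omega> (J h)) (multiword_op V \<sigma> (J k)))"
proof (cases "hilbert_space X \<and> isometry H X J \<and> commuting_row_isometries X ns V")
  case True
  then interpret commuting_isometries X ns V
    by (simp add: commuting_isometries_def commuting_isometries_axioms_def)
  have "J (K \<sigma> \<omega> h) = orth_proj X (J ` hcarrier H) (adj X (multiword_op V \<sigma>) (multiword_op V \<omega> (J h)))
      \<longleftrightarrow> (\<forall>k\<in>hcarrier H. hinner H (K \<sigma> \<omega> h) k =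
        hinner X (multiword_op V \<omega> (J h)) (multiword_op V \<sigma> (J k)))"
    if "\<sigma> \<in> multiwords ns" "\<omega> \<in> multiwords ns" "h \<in> hcarrier H" for \<sigma> \<omega> h
    using True that assms isometryD(2)[OF multiword_op_isometry] isometryD(2)[of H X J]
    by (intro eq_orth_proj_adj_iff multiword_op_isometry) (auto simp: bounded_op_def linear_op_def)
  then show ?thesis
    using True by (simp add: naimark_dilation_def)
qed (auto simp: naimark_dilation_def)

section \<open>From a dilation to the properties of the kernel\<close>

lemma multi_toeplitz_if_dilation:
  assumes "hilbert_space H" and K: "\<forall>\<sigma>\<in>multiwords ns. \<forall>\<omega>\<in>multiwords ns. bounded_op H (K \<sigma> \<omega>)"
    and "naimark_dilation ns H K X J V"
  shows "multi_toeplitz ns H K"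
proof -
  have gram: "hinner H (K \<sigma> \<omega> h) k = hinner X (multiword_op V \<omega> (J h)) (multiword_op V \<sigma> (J k))"
    if "\<sigma> \<in> multiwords ns" "\<omega> \<in> multiwords ns" "h \<in> hcarrier H" "k \<in> hcarrier H" for \<sigma> \<omega> h k
    using assms(3) that unfolding naimark_dilation_iff_gram[OF assms(1,2)] by blast
  interpret H: hilbert_space H by fact
  interpret commuting_isometries X ns V
    using assms(3) by (simp add: naimark_dilation_def commuting_isometries_def commuting_isometries_axioms_def)
  have iso: "isometry H X J"
    using assms(3) by (simp add: naimark_dilation_def)
  have K_mem: "K \<sigma> \<omega> h \<in> hcarrier H"
    if "\<sigma> \<in> multiwords ns" "\<omega> \<in> multiwords ns" "h \<in> hcarrier H" for \<sigma> \<omega> h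
    using K that by (simp add: bounded_op_def linear_op_def)
  \<comment> \<open>Hence the Gram identity at the neutral multiword compares \<open>h\<close> with
    \<open>J h\<close>, and the normalization of \<open>K\<close> follows from \<open>J\<close>
    being isometric.\<close>
  have "multiword_op V (neutral ns) x = x" for x
  proof -
    have "foldr (\<lambda>i. foldr (V i) (neutral ns ! i)) L x = x" if "set L \<subseteq> {..<length ns}" for L
      using that by (induction L) (simp_all add: neutral_def)
    from this[of "[0..<length ns]"] show ?thesis
      unfolding multiword_op_factors[OF neutral_mem] by (simp add: atLeast0LessThan)
  qed
  then have "K (neutral ns) (neutral ns) h = h" if "h \<in> hcarrier H" for h
    using that isometry_hinner[OF H.semi_inner_space_axioms semi_inner_space_axioms iso]
    by (intro H.hinner_left_eqI) (simp_all add: K_mem neutral_mem gram)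
  moreover have "K \<sigma> \<omega> h = (if left_comparable \<sigma> \<omega> then K (map2 c_plus \<sigma> \<omega>) (map2 c_minus \<sigma> \<omega>) h else 0)"
    if "\<sigma> \<in> multiwords ns" "\<omega> \<in> multiwords ns" "h \<in> hcarrier H" for \<sigma> \<omega> h
    using that isometryD(2)[OF iso]
    by (intro H.hinner_left_eqI) (auto simp: K_mem map2_c_mem gram multiword_op_gram)
  ultimately show ?thesis
    by (simp add: multi_toeplitz_def)
qed

lemma pos_semidef_if_dilation:
  assumes "hilbert_space H" and K: "\<forall>\<sigma>\<in>multiwords ns. \<forall>\<omega>\<in>multiwords ns. bounded_op H (K \<sigma> \<omega>)"
    and dil: "naimark_dilation ns H K X J V"
  shows "pos_semidef ns H K"
  unfolding pos_semidef_def
proof (intro allI impI)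
  fix m :: nat and h \<sigma> assume h: "\<forall>i<m. h i \<in> hcarrier H \<and> \<sigma> i \<in> multiwords ns"
  interpret commuting_isometries X ns V
    using dil by (simp add: naimark_dilation_def commuting_isometries_def commuting_isometries_axioms_def)
  let ?x = "\<lambda>i. multiword_op V (\<sigma> i) (J (h i))"
  have mem: "?x i \<in> hcarrier X" if "i < m" for i
    using h that dil isometryD(2)[OF multiword_op_isometry] isometryD(2)
    unfolding naimark_dilation_def by metis
  have "(\<Sum>i<m. \<Sum>j<m. hinner H (K (\<sigma> i) (\<sigma> j) (h j)) (h i)) = (\<Sum>i<m. \<Sum>j<m. hinner X (?x j) (?x i))"
    using h dil unfolding naimark_dilation_iff_gram[OF assms(1,2)] by (intro sum.cong refl) auto
  also have "\<dots> = (\<Sum>i<m. hinner X (\<Sum>j<m. ?x j) (?x i))"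
    using mem by (intro sum.cong refl hinner_sum_left[symmetric]) auto
  also have "\<dots> = hinner X (\<Sum>j<m. ?x j) (\<Sum>i<m. ?x i)"
    using mem by (intro hinner_sum_right[symmetric] mem_sum) auto
  also have "\<dots> \<in> \<real>\<^sub>\<ge>\<^sub>0"
    using mem by (intro hinner_self_nonneg mem_sum) auto
  finally show "(\<Sum>i<m. \<Sum>j<m. hinner H (K (\<sigma> i) (\<sigma> j) (h j)) (h i)) \<in> \<real>\<^sub>\<ge>\<^sub>0" .
qed

lemma kernel_if_has_dilation:
  assumes "hilbert_space H" "\<forall>\<sigma>\<in>multiwords ns. \<forall>\<omega>\<in>multiwords ns. bounded_op H (K \<sigma> \<omega>)"
    and "has_naimark_dilation TYPE('b::ab_group_add) ns H K"
  shows "pos_semidef ns H K \<and> multi_toeplitz ns H K"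
  using assms(3) pos_semidef_if_dilation[OF assms(1,2)] multi_toeplitz_if_dilation[OF assms(1,2)]
  unfolding has_naimark_dilation_def by blast

section \<open>From a positive multi-Toeplitz kernel to a dilation\<close>

lemma pos_semidef_fin_supp:
  assumes "semi_inner_space H" "pos_semidef ns H K" and u: "u \<in> fin_supp (multiwords ns) H"
  shows "(\<Sum>\<sigma> | u \<sigma> \<noteq> 0. \<Sum>\<omega> | u \<omega> \<noteq> 0. hinner H (K \<sigma> \<omega> (u \<omega>)) (u \<sigma>)) \<in> \<real>\<^sub>\<ge>\<^sub>0"
proof -
  interpret H: semi_inner_space H by fact
  let ?S = "{\<sigma>. u \<sigma> \<noteq> 0}"
  \<comment> \<open>Enumerating the support turns the sum over multiwords into an instance of
    \<open>pos_semidef\<close>.\<close>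
  obtain g where g: "bij_betw g {..<card ?S} ?S"
    using ex_bij_betw_nat_finite[OF H.fin_suppD(2)[OF u]] by (auto simp: atLeast0LessThan)
  have reindex: "sum f ?S = (\<Sum>i<card ?S. f (g i))" for f :: "_ \<Rightarrow> complex"
    by (rule sum.reindex_bij_betw[OF g, symmetric])
  have "g i \<in> ?S" if "i < card ?S" for i
    using g that by (auto simp: bij_betw_def)
  then show ?thesis
    using assms(2) H.fin_suppD[OF u] unfolding reindex pos_semidef_def by auto
qed

theorem dilation_of_pos_semidef_multi_toeplitz:
  fixes H :: "'h::ab_group_add hspace"
  assumes "hilbert_space H" and K: "\<forall>\<sigma>\<in>multiwords ns. \<forall>\<omega>\<in>multiwords ns. bounded_op H (K \<sigma> \<omega>)"
    and psd: "pos_semidef ns H K" and toeplitz: "multi_toeplitz ns H K"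
  shows "\<exists>(X :: (nat list list \<Rightarrow> 'h) hspace) J V. naimark_dilation ns H K X J V"
proof -
  interpret H: hilbert_space H by fact
  let ?I = "multiwords ns"
  obtain X :: "(nat list list \<Rightarrow> 'h) hspace" and e where X: "hilbert_space X"
    and total: "total_family ?I H X e"
    and gram: "\<And>\<sigma> \<omega> h k. \<lbrakk>\<sigma> \<in> ?I; \<omega> \<in> ?I; h \<in> hcarrier H; k \<in> hcarrier H\<rbrakk> \<Longrightarrow>
      hinner X (e \<omega> h) (e \<sigma> k) = hinner H (K \<sigma> \<omega> h) k"
    using kolmogorov_decomposition[OF assms(1), of ?I K] K
      pos_semidef_fin_supp[OF H.semi_inner_space_axioms psd] by blast
  interpret X: hilbert_space X by fact
  have e_lin: "linear_op H X (e \<sigma>)" if "\<sigma> \<in> ?I" for \<sigma>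
    using total that by (simp add: total_family_def)
  have cons_mem: "\<sigma>[i := j # \<sigma> ! i] \<in> ?I" if "\<sigma> \<in> ?I" "i < length ns" "j \<in> {1..ns ! i}" for \<sigma> i j
    using prepend_mem[OF that(1,2), of "[j]"] that(3) by simp
  \<comment> \<open>The Gram condition of \<open>total_family_isometry\<close> is the shift property
    with equal letters.\<close>
  have "\<exists>T. isometry X X T \<and> (\<forall>\<sigma>\<in>?I. \<forall>h\<in>hcarrier H. T (e \<sigma> h) = e (\<sigma>[i := j # \<sigma> ! i]) h)"
    if "i < length ns" "j \<in> {1..ns ! i}" for i j
    by (rule total_family_isometry[OF H.semi_inner_space_axioms X X total])
      (use that in \<open>auto simp: gram cons_mem e_lin multi_toeplitz_shift[OF toeplitz]\<close>)
  then obtain V where V_iso: "\<And>i j. \<lbrakk>i < length ns; j \<in> {1..ns ! i}\<rbrakk> \<Longrightarrow> isometry X X (V i j)"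
    and V: "\<And>i j \<sigma> h. \<lbrakk>i < length ns; j \<in> {1..ns ! i}; \<sigma> \<in> ?I; h \<in> hcarrier H\<rbrakk> \<Longrightarrow>
      V i j (e \<sigma> h) = e (\<sigma>[i := j # \<sigma> ! i]) h"
    by metis
  have "hinner X (V i s x) (V i t y) = 0"
    if "i < length ns" "s \<in> {1..ns ! i}" "t \<in> {1..ns ! i}" "s \<noteq> t" "x \<in> hcarrier X" "y \<in> hcarrier X"
    for i s t x y
    by (rule isometries_orthogonalI[OF H.semi_inner_space_axioms X.semi_inner_space_axioms
          X.semi_inner_space_axioms total V_iso[OF that(1,2)] V_iso[OF that(1,3)]])
      (use that in \<open>auto simp: V gram cons_mem multi_toeplitz_shift[OF toeplitz]\<close>)
  moreover have "V i j (V s t x) = V s t (V i j x)"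
    if "i < length ns" "s < length ns" "i \<noteq> s" "j \<in> {1..ns ! i}" "t \<in> {1..ns ! s}" "x \<in> hcarrier X"
    for i s j t x
  proof -
    \<comment> \<open>Both composites are isometries, and on the total family they agree because
      list updates at different positions commute.\<close>
    have "(V i j \<circ> V s t) x = (V s t \<circ> V i j) x"
      by (rule isometries_eqI[OF H.semi_inner_space_axioms X.semi_inner_space_axioms X total
            isometry_comp[OF V_iso[OF that(2,5)] V_iso[OF that(1,4)]]
            isometry_comp[OF V_iso[OF that(1,4)] V_iso[OF that(2,5)]] _ that(6)])
        (use that in \<open>auto simp: V cons_mem list_update_swap\<close>)
    then show ?thesis
      by simp
  qed
  ultimately have commuting: "commuting_row_isometries X ns V"
    unfolding commuting_row_isometries_def row_isometry_def using V_iso by blast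
  interpret commuting_isometries X ns V
    by unfold_locales (rule commuting)
  have word: "foldr (V i) w (e \<sigma> h) = e (\<sigma>[i := w @ \<sigma> ! i]) h"
    if "\<sigma> \<in> ?I" "h \<in> hcarrier H" "i < length ns" "set w \<subseteq> {1..ns ! i}" for i w \<sigma> h
    using that(4)
  proof (induction w)
    case (Cons a w)
    then show ?case
      using that prepend_mem[OF that(1,3), of w] multiwordsD(1)[OF that(1)] by (simp add: V)
  qed simp
  \<comment> \<open>Generalized to partial lists for the induction: the factors at the positions in
    \<open>L\<close> fill in these components of the neutral multiword and leave the others
    empty.\<close>
  have factors: "factors L \<sigma> (e (neutral ns) h) =
      e (map (\<lambda>i. if i \<in> set L then \<sigma> ! i else []) [0..<length ns]) h"
    if \<sigma>: "\<sigma> \<in> ?I" and h: "h \<in> hcarrier H" and "set L \<subseteq> {..<length ns}" "distinct L" for L \<sigma> h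
    using that(3,4)
  proof (induction L)
    case Nil
    have "neutral ns = map (\<lambda>i. []) [0..<length ns]"
      by (rule nth_equalityI) (simp_all add: neutral_def)
    then show ?case by simp
  next
    case (Cons s L)
    let ?\<tau> = "map (\<lambda>i. if i \<in> set L then \<sigma> ! i else []) [0..<length ns]"
    have \<tau>: "?\<tau> \<in> ?I"
      using multiwordsD(2)[OF \<sigma>] by (intro multiwordsI) auto
    have "factors (s # L) \<sigma> (e (neutral ns) h) = e (?\<tau>[s := \<sigma> ! s @ ?\<tau> ! s]) h"
      using Cons word[OF \<tau> h, of s "\<sigma> ! s"] multiwordsD(2)[OF \<sigma>] by simp
    also have "?\<tau>[s := \<sigma> ! s @ ?\<tau> ! s] = map (\<lambda>i. if i \<in> set (s # L) then \<sigma> ! i else []) [0..<length ns]"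
      using Cons.prems by (intro nth_equalityI) (auto simp: nth_list_update)
    finally show ?case .
  qed
  have op: "multiword_op V \<sigma> (e (neutral ns) h) = e \<sigma> h" if "\<sigma> \<in> ?I" "h \<in> hcarrier H" for \<sigma> h
  proof -
    have "map (\<lambda>i. if i \<in> set [0..<length ns] then \<sigma> ! i else []) [0..<length ns] = \<sigma>"
      using multiwordsD(1)[OF that(1)] by (intro nth_equalityI) auto
    then show ?thesis
      using factors[OF that, of "[0..<length ns]"] multiword_op_factors[OF that(1)]
      by (simp add: atLeast0LessThan)
  qed
  have "isometry H X (e (neutral ns))"
    by (rule isometryI[OF e_lin[OF neutral_mem]])
      (simp add: gram neutral_mem multi_toeplitzD(1)[OF toeplitz])
  \<comment> \<open>By \<open>op\<close>, the Gram identity of the dilation is the Gram identity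
    \<open>gram\<close> of the decomposition.\<close>
  then have "naimark_dilation ns H K X (e (neutral ns)) V"
    unfolding naimark_dilation_iff_gram[OF assms(1) K] using X commuting by (simp add: op gram)
  then show ?thesis
    by blast
qed

text \<open>The equivalence fixes the ambient type in which the reproducing kernel space lives. With
  the second conjunct, a dilation in an arbitrary type \<open>'b\<close> already forces one in that
  type.\<close>

theorem theorem3p2:
  fixes ns :: "nat list"
    and H :: "'h::ab_group_add hspace"
    and K :: "nat list list \<Rightarrow> nat list list \<Rightarrow> 'h \<Rightarrow> 'h"
  assumes "ns \<noteq> []"
    and "\<forall>n\<in>set ns. n \<ge> 1"
    and "hilbert_space H"
    and "\<forall>\<sigma>\<in>multiwords ns. \<forall>\<omega>\<in>multiwords ns. bounded_op H (K \<sigma> \<omega>)"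
  shows "((pos_semidef ns H K \<and> multi_toeplitz ns H K) \<longleftrightarrow>
      has_naimark_dilation TYPE(nat list list \<Rightarrow> 'h) ns H K) \<and>
    (has_naimark_dilation TYPE('b::ab_group_add) ns H K \<longrightarrow>
      pos_semidef ns H K \<and> multi_toeplitz ns H K)"
proof (intro conjI impI iffI)
  assume "pos_semidef ns H K \<and> multi_toeplitz ns H K"
  then show "has_naimark_dilation TYPE(nat list list \<Rightarrow> 'h) ns H K"
    unfolding has_naimark_dilation_def
    using dilation_of_pos_semidef_multi_toeplitz[OF assms(3,4)] by blast
qed (use kernel_if_has_dilation[OF assms(3,4)] in blast)+

end
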